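(* Let $(\mathcal{C},P),(\mathcal{D},Q)\in\mathrm{Ob}(\mathbf{FA})$ and let $F:(\mathcal{C},P)\to(\mathcal{D},Q)$ be a morphism of $\mathbf{FA}$. Then for every theory $T$ and every $T$-model $S$ in $(\mathcal{C},P)$, the structure $F(S)$ in $(\mathcal{D},Q)$ is a $T$-model.
   Context: Syntax: a first-order language $\mathscr{L}$ has quantifier symbols $\mathscr{L}_q$ and connectives $\mathscr{L}_\omega$ with arities (designated $e\in\mathscr{L}_0$, $\otimes\in\mathscr{L}_2$). Signatures have sorts, function symbols $f:\sigma_1..\sigma_n\to\tau$ and relation symbols $R\subseteq\sigma_1..\sigma_n$; contexts $\Gamma=x_1:\sigma_1..x_n:\sigma_n$; terms-in-context $M:\tau\ [\Gamma]$; formulas-in-context from $R(\vec M)$, $M_1=_\sigma M_2$, $\Diamond(\vec\phi)$ ($\Diamond\in\mathscr{L}_n$), $\Omega_{x:\sigma}(\phi)\ [\Gamma]$ from $\phi\ [\Gamma,x:\sigma]$. Assertions: equations $M_1=M_2:\tau\ [\Gamma]$ and sequents $\phi_1..\phi_n\vdash\phi\ [\Gamma]$; a theory $T$ is a set of assertions over a signature. $\mathrm{Ob}(\mathbf{FA})$: categories $\mathcal{C}$ with designated finite products and contravariant $P:\mathcal{C}\to\mathbf{Pos}$, with $\mathscr{L}_\omega$-algebra structures on each $P(c)$ preserved by each $P(f)$, elements $Eq_c\in P(c\times c)$, and maps $\Omega_{b,c}:P(b\times c)\to P(b)$ natural in $b$ ($\Omega\in\mathscr{L}_q$), such that $(P(c),\otimes,e_c)$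 is a monoid, $\Omega_{b,1}\circ P(\pi_1^{b,1})=\mathrm{id}$, $\Omega_{b,c\times d}\circ P(a_{b,c,d})=\Omega_{b,c}\circ\Omega_{b\times c,d}$ ($a_{b,c,d}:b\times(c\times d)\to(b\times c)\times d$ canonical), $Eq_1=e_{1\times 1}$, $Eq_{c_1\times c_2}=P(\langle\pi_1^{c_1,c_2}\pi_1,\pi_1^{c_1,c_2}\pi_2\rangle)(Eq_{c_1})\otimes P(\langle\pi_2^{c_1,c_2}\pi_1,\pi_2^{c_1,c_2}\pi_2\rangle)(Eq_{c_2})$. Structures: an $Sg$-structure $S$ in $(\mathcal{C},P)$ assigns objects $S[\![\sigma]\!]$, morphisms $S[\![f]\!]:S[\![\sigma_1]\!]\times\dots\times S[\![\sigma_n]\!]\to S[\![\tau]\!]$, elements $S[\![R]\!]\in P(S[\![\sigma_1]\!]\times\dots\times S[\![\sigma_n]\!])$; $S[\![\Gamma]\!]$ is the product of the sorts of $\Gamma$. Terms: variables are projections, $[\![f(\vec M)]\!]=[\![f]\!]\circ\langle[\![M_i]\!]\rangle$. Formulas: $[\![R(\vec M)]\!]=P(\langle[\![M_i]\!]\rangle)([\![R]\!])$; $[\![M_1=_\tau M_2]\!]=P(\langle[\![M_1]\!],[\![M_2]\!]\rangle)(Eq_{[\![\tau]\!]})$; connectives interpreted in $P([\![\Gamma]\!])$; $[\![\Omega_{x:\sigma}\phi\ [\Gamma]]\!]=\Omega_{[\![\Gamma]\!],[\![\sigma]\!]}(P(a)([\![\phi\ [\Gamma,x:\sigma]]\!]))$,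 $a:[\![\Gamma]\!]\times[\![\sigma]\!]\to[\![\Gamma,x:\sigma]\!]$ canonical iso. $S$ satisfies an equation if both sides are interpreted by equal morphisms, a sequent $\phi_1..\phi_n\vdash\phi\ [\Gamma]$ if $[\![\phi_1]\!]\otimes\dots\otimes[\![\phi_n]\!]\le[\![\phi]\!]$ ($e_{[\![\Gamma]\!]}$ if $n=0$); $S$ is a $T$-model if it satisfies every assertion of $T$. Morphisms: $F:(\mathcal{C},P)\to(\mathcal{D},Q)$ is a finite-product-preserving functor $F^o:\mathcal{C}\to\mathcal{D}$ with a natural transformation $F^p:P\Rightarrow Q\circ F^o$ such that each $F^p_c$ is an $\mathscr{L}_\omega$-homomorphism, $F^p_b\circ\Omega_{b,c}=\Omega_{F^ob,F^oc}\circ Q(a_{F,b,c}^{-1})\circ F^p_{b\times c}$, and $F^p_{c\times c}(Eq_c)=Q(a_{F,c,c})(Eq_{F^oc})$, where $a_{F,b,c}:F^o(b\times c)\to F^ob\times F^oc$ is the canonical iso. The structure $F(S)$: $F(S)[\![\sigma]\!]=F^o(S[\![\sigma]\!])$; for $f:\sigma_1..\sigma_n\to\tau$, $F(S)[\![f]\!]=F^o(S[\![f]\!])\circ a_\Gamma^{-1}$; for $R\subseteq\sigma_1..\sigma_n$, $F(S)[\![R]\!]=Q(a_\Gamma^{-1})(F^p_{S[\![\Gamma]\!]}(S[\![R]\!]))$, where $\Gamma=x_1:\sigma_1..x_n:\sigma_n$ and $a_\Gamma:F^o(S[\![\Gamma]\!])\to F(S)[\![\Gamma]\!]$ is the canonical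 isomorphism. *)

theory Defs
  imports "HOL-Algebra.Order" "HOL-Algebra.Group"
begin

section \<open>Syntax\<close>

record ('k, 'q) lang =
  Quants :: "'q set"
  Conns :: "'k set"
  con_arity :: "'k \<Rightarrow> nat"
  unit_con :: 'k
  tensor_con :: 'k

definition conns_of_arity :: "('k, 'q) lang \<Rightarrow> nat \<Rightarrow> 'k set" where
  "conns_of_arity L n = {k \<in> Conns L. con_arity L k = n}"

locale language =
  fixes L :: "('k, 'q) lang"
  assumes unit_con: "unit_con L \<in> conns_of_arity L 0"
    and tensor_con: "tensor_con L \<in> conns_of_arity L 2"

record ('s, 'f, 'r) sig =
  Sorts :: "'s set"
  Funs :: "'f set"
  fun_dom :: "'f \<Rightarrow> 's list"
  fun_cod :: "'f \<Rightarrow> 's"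
  Rels :: "'r set"
  rel_dom :: "'r \<Rightarrow> 's list"

locale signature =
  fixes Sg :: "('s, 'f, 'r) sig"
  assumes fun_dom: "f \<in> Funs Sg \<Longrightarrow> set (fun_dom Sg f) \<subseteq> Sorts Sg"
    and fun_cod: "f \<in> Funs Sg \<Longrightarrow> fun_cod Sg f \<in> Sorts Sg"
    and rel_dom: "R \<in> Rels Sg \<Longrightarrow> set (rel_dom Sg R) \<subseteq> Sorts Sg"

type_synonym ('v, 's) ctx = "('v \<times> 's) list"

definition ctx_over :: "('s, 'f, 'r) sig \<Rightarrow> ('v, 's) ctx \<Rightarrow> bool" where
  "ctx_over Sg \<Gamma> \<longleftrightarrow> distinct (map fst \<Gamma>) \<and> set (map snd \<Gamma>) \<subseteq> Sorts Sg"

datatype ('f, 'v) tm = Var 'v | Fn 'f "('f, 'v) tm list"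

datatype ('s, 'f, 'r, 'k, 'q, 'v) fm =
    Rel 'r "('f, 'v) tm list"
  | Equal 's "('f, 'v) tm" "('f, 'v) tm"
  | Conn 'k "('s, 'f, 'r, 'k, 'q, 'v) fm list"
  | Quant 'q 'v 's "('s, 'f, 'r, 'k, 'q, 'v) fm"

inductive tm_in_ctx :: "('s, 'f, 'r) sig \<Rightarrow> ('v, 's) ctx \<Rightarrow> ('f, 'v) tm \<Rightarrow> 's \<Rightarrow> bool"
  for Sg :: "('s, 'f, 'r) sig" and \<Gamma> :: "('v, 's) ctx" where
  Var: "(x, \<sigma>) \<in> set \<Gamma> \<Longrightarrow> tm_in_ctx Sg \<Gamma> (Var x) \<sigma>"
| Fn: "f \<in> Funs Sg \<Longrightarrow> list_all2 (tm_in_ctx Sg \<Gamma>) Ms (fun_dom Sg f) \<Longrightarrow>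
    tm_in_ctx Sg \<Gamma> (Fn f Ms) (fun_cod Sg f)"

inductive fm_in_ctx ::
  "('k, 'q) lang \<Rightarrow> ('s, 'f, 'r) sig \<Rightarrow> ('v, 's) ctx \<Rightarrow> ('s, 'f, 'r, 'k, 'q, 'v) fm \<Rightarrow> bool"
  for L :: "('k, 'q) lang" and Sg :: "('s, 'f, 'r) sig" where
  Rel: "R \<in> Rels Sg \<Longrightarrow> list_all2 (tm_in_ctx Sg \<Gamma>) Ms (rel_dom Sg R) \<Longrightarrow>
    fm_in_ctx L Sg \<Gamma> (Rel R Ms)"
| Equal: "tm_in_ctx Sg \<Gamma> M \<sigma> \<Longrightarrow> tm_in_ctx Sg \<Gamma> N \<sigma> \<Longrightarrow> fm_in_ctx L Sg \<Gamma> (Equal \<sigma> M N)"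
| Conn: "k \<in> conns_of_arity L (length \<phi>s) \<Longrightarrow> \<forall>\<phi> \<in> set \<phi>s. fm_in_ctx L Sg \<Gamma> \<phi> \<Longrightarrow>
    fm_in_ctx L Sg \<Gamma> (Conn k \<phi>s)"
| Quant: "q \<in> Quants L \<Longrightarrow> ctx_over Sg (\<Gamma> @ [(x, \<sigma>)]) \<Longrightarrow> fm_in_ctx L Sg (\<Gamma> @ [(x, \<sigma>)]) \<phi> \<Longrightarrow>
    fm_in_ctx L Sg \<Gamma> (Quant q x \<sigma> \<phi>)"

datatype ('s, 'f, 'r, 'k, 'q, 'v) assertion =
    Equation "('v, 's) ctx" 's "('f, 'v) tm" "('f, 'v) tm"
  | Sequent "('v, 's) ctx" "('s, 'f, 'r, 'k, 'q, 'v) fm list" "('s, 'f, 'r, 'k, 'q, 'v) fm"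

fun assertion_over ::
  "('k, 'q) lang \<Rightarrow> ('s, 'f, 'r) sig \<Rightarrow> ('s, 'f, 'r, 'k, 'q, 'v) assertion \<Rightarrow> bool" where
  "assertion_over L Sg (Equation \<Gamma> \<tau> M N) \<longleftrightarrow>
     ctx_over Sg \<Gamma> \<and> tm_in_ctx Sg \<Gamma> M \<tau> \<and> tm_in_ctx Sg \<Gamma> N \<tau>"
| "assertion_over L Sg (Sequent \<Gamma> \<phi>s \<phi>) \<longleftrightarrow>
     ctx_over Sg \<Gamma> \<and> (\<forall>\<psi> \<in> set \<phi>s. fm_in_ctx L Sg \<Gamma> \<psi>) \<and> fm_in_ctx L Sg \<Gamma> \<phi>"

definition theory_over ::
  "('k, 'q) lang \<Rightarrow> ('s, 'f, 'r) sig \<Rightarrow> ('s, 'f, 'r, 'k, 'q, 'v) assertion set \<Rightarrow> bool" where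
  "theory_over L Sg T \<longleftrightarrow> (\<forall>A \<in> T. assertion_over L Sg A)"


section \<open>Categories with designated finite products\<close>

record ('o, 'm) cat =
  Ob :: "'o set"
  Arr :: "'m set"
  Dom :: "'m \<Rightarrow> 'o"
  Cod :: "'m \<Rightarrow> 'o"
  Ide :: "'o \<Rightarrow> 'm"
  Cmp :: "'m \<Rightarrow> 'm \<Rightarrow> 'm"  (* \<open>Cmp C g f\<close> is g after f *)

definition hom_set :: "('o, 'm, 'z) cat_scheme \<Rightarrow> 'o \<Rightarrow> 'o \<Rightarrow> 'm set" where
  "hom_set C a b = {f \<in> Arr C. Dom C f = a \<and> Cod C f = b}"

locale category =
  fixes C :: "('o, 'm, 'z) cat_scheme"
  assumes dom_in_Ob: "f \<in> Arr C \<Longrightarrow> Dom C f \<in> Ob C"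
    and cod_in_Ob: "f \<in> Arr C \<Longrightarrow> Cod C f \<in> Ob C"
    and ide_in_hom: "a \<in> Ob C \<Longrightarrow> Ide C a \<in> hom_set C a a"
    and cmp_in_hom: "f \<in> hom_set C a b \<Longrightarrow> g \<in> hom_set C b c \<Longrightarrow> Cmp C g f \<in> hom_set C a c"
    and cmp_ide: "f \<in> hom_set C a b \<Longrightarrow> Cmp C f (Ide C a) = f"
    and ide_cmp: "f \<in> hom_set C a b \<Longrightarrow> Cmp C (Ide C b) f = f"
    and cmp_assoc: "f \<in> hom_set C a b \<Longrightarrow> g \<in> hom_set C b c \<Longrightarrow> h \<in> hom_set C c d \<Longrightarrow>
      Cmp C (Cmp C h g) f = Cmp C h (Cmp C g f)"

definition inverse_arr :: "('o, 'm, 'z) cat_scheme \<Rightarrow> 'm \<Rightarrow> 'm" where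
  "inverse_arr C f = (THE g. g \<in> hom_set C (Cod C f) (Dom C f) \<and>
     Cmp C g f = Ide C (Dom C f) \<and> Cmp C f g = Ide C (Cod C f))"

definition is_cone :: "('o, 'm, 'z) cat_scheme \<Rightarrow> 'o list \<Rightarrow> 'o \<Rightarrow> 'm list \<Rightarrow> bool" where
  "is_cone C cs x fs \<longleftrightarrow> x \<in> Ob C \<and> set cs \<subseteq> Ob C \<and> list_all2 (\<lambda>f c. f \<in> hom_set C x c) fs cs"

definition is_product :: "('o, 'm, 'z) cat_scheme \<Rightarrow> 'o list \<Rightarrow> 'o \<Rightarrow> 'm list \<Rightarrow> bool" where
  "is_product C cs p ps \<longleftrightarrow> is_cone C cs p ps \<and>
     (\<forall>x fs. is_cone C cs x fs \<longrightarrow> (\<exists>!h. h \<in> hom_set C x p \<and> map (\<lambda>q. Cmp C q h) ps = fs))"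

text \<open>A product is designated for every finite list of objects, so that the unary product of
  \<open>[c]\<close> need not be \<open>c\<close> and ternary products need not be iterated binary ones. The terminal
  object and the binary products are the designated products of the lists of length 0 and 2.\<close>

record ('o, 'm) prod_cat = "('o, 'm) cat" +
  Prd :: "'o list \<Rightarrow> 'o"
  Prj :: "'o list \<Rightarrow> 'm list"

locale product_category = category C
  for C :: "('o, 'm, 'z) prod_cat_scheme" +
  assumes designated_product: "set cs \<subseteq> Ob C \<Longrightarrow> is_product C cs (Prd C cs) (Prj C cs)"

definition tuple :: "('o, 'm, 'z) prod_cat_scheme \<Rightarrow> 'o \<Rightarrow> 'm list \<Rightarrow> 'm" where
  "tuple C x fs = (THE h. h \<in> hom_set C x (Prd C (map (Cod C) fs)) \<and>
     map (\<lambda>q. Cmp C q h) (Prj C (map (Cod C) fs)) = fs)"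

definition one_ob :: "('o, 'm, 'z) prod_cat_scheme \<Rightarrow> 'o" where
  "one_ob C = Prd C []"

definition times_ob :: "('o, 'm, 'z) prod_cat_scheme \<Rightarrow> 'o \<Rightarrow> 'o \<Rightarrow> 'o" where
  "times_ob C b c = Prd C [b, c]"

definition proj1 :: "('o, 'm, 'z) prod_cat_scheme \<Rightarrow> 'o \<Rightarrow> 'o \<Rightarrow> 'm" where
  "proj1 C b c = Prj C [b, c] ! 0"

definition proj2 :: "('o, 'm, 'z) prod_cat_scheme \<Rightarrow> 'o \<Rightarrow> 'o \<Rightarrow> 'm" where
  "proj2 C b c = Prj C [b, c] ! 1"

definition pair :: "('o, 'm, 'z) prod_cat_scheme \<Rightarrow> 'm \<Rightarrow> 'm \<Rightarrow> 'm" where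
  "pair C f g = tuple C (Dom C f) [f, g]"

definition times_ide :: "('o, 'm, 'z) prod_cat_scheme \<Rightarrow> 'm \<Rightarrow> 'o \<Rightarrow> 'm" where
  "times_ide C f c = pair C (Cmp C f (proj1 C (Dom C f) c)) (proj2 C (Dom C f) c)"

definition assoc_arr :: "('o, 'm, 'z) prod_cat_scheme \<Rightarrow> 'o \<Rightarrow> 'o \<Rightarrow> 'o \<Rightarrow> 'm" where
  "assoc_arr C b c d =
     (let p = proj1 C b (times_ob C c d); q = proj2 C b (times_ob C c d)
      in pair C (pair C p (Cmp C (proj1 C c d) q)) (Cmp C (proj2 C c d) q))"


section \<open>Objects of FA\<close>

record ('o, 'm, 'p, 'k, 'q) fa = "('o, 'm) prod_cat" +
  Fib :: "'o \<Rightarrow> 'p gorder"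
  Pull :: "'m \<Rightarrow> 'p \<Rightarrow> 'p"
  Con :: "'o \<Rightarrow> 'k \<Rightarrow> 'p list \<Rightarrow> 'p"
  Eql :: "'o \<Rightarrow> 'p"
  Qnt :: "'q \<Rightarrow> 'o \<Rightarrow> 'o \<Rightarrow> 'p \<Rightarrow> 'p"

abbreviation elts :: "('o, 'm, 'p, 'k, 'q, 'z) fa_scheme \<Rightarrow> 'o \<Rightarrow> 'p set" where
  "elts C c \<equiv> carrier (Fib C c)"

definition unit_elt :: "('k, 'q) lang \<Rightarrow> ('o, 'm, 'p, 'k, 'q, 'z) fa_scheme \<Rightarrow> 'o \<Rightarrow> 'p" where
  "unit_elt L C c = Con C c (unit_con L) []"

definition tensor ::
  "('k, 'q) lang \<Rightarrow> ('o, 'm, 'p, 'k, 'q, 'z) fa_scheme \<Rightarrow> 'o \<Rightarrow> 'p \<Rightarrow> 'p \<Rightarrow> 'p" where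
  "tensor L C c x y = Con C c (tensor_con L) [x, y]"

text \<open>The maps \<open>Qnt C q b c\<close> and the operations \<open>Con C c k\<close> are maps of underlying sets; they are
  not required to be monotone.\<close>

locale fa_object = language L + product_category C
  for L :: "('k, 'q) lang" and C :: "('o, 'm, 'p, 'k, 'q) fa" +
  assumes fib_poset: "c \<in> Ob C \<Longrightarrow> partial_order (Fib C c)"
    and pull_elts: "f \<in> hom_set C b c \<Longrightarrow> Pull C f \<in> elts C c \<rightarrow> elts C b"
    and pull_mono: "f \<in> hom_set C b c \<Longrightarrow> isotone (Fib C c) (Fib C b) (Pull C f)"
    and pull_ide: "c \<in> Ob C \<Longrightarrow> x \<in> elts C c \<Longrightarrow> Pull C (Ide C c) x = x"
    and pull_cmp: "f \<in> hom_set C a b \<Longrightarrow> g \<in> hom_set C b c \<Longrightarrow> x \<in> elts C c \<Longrightarrow>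
      Pull C (Cmp C g f) x = Pull C f (Pull C g x)"
    and con_elts: "c \<in> Ob C \<Longrightarrow> k \<in> conns_of_arity L (length xs) \<Longrightarrow> set xs \<subseteq> elts C c \<Longrightarrow>
      Con C c k xs \<in> elts C c"
    and pull_con: "f \<in> hom_set C b c \<Longrightarrow> k \<in> conns_of_arity L (length xs) \<Longrightarrow>
      set xs \<subseteq> elts C c \<Longrightarrow> Pull C f (Con C c k xs) = Con C b k (map (Pull C f) xs)"
    and eql_elts: "c \<in> Ob C \<Longrightarrow> Eql C c \<in> elts C (times_ob C c c)"
    and qnt_elts: "q \<in> Quants L \<Longrightarrow> b \<in> Ob C \<Longrightarrow> c \<in> Ob C \<Longrightarrow>
      Qnt C q b c \<in> elts C (times_ob C b c) \<rightarrow> elts C b"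
    and qnt_natural: "q \<in> Quants L \<Longrightarrow> f \<in> hom_set C a b \<Longrightarrow> c \<in> Ob C \<Longrightarrow>
      x \<in> elts C (times_ob C b c) \<Longrightarrow>
      Pull C f (Qnt C q b c x) = Qnt C q a c (Pull C (times_ide C f c) x)"
    and tensor_monoid: "c \<in> Ob C \<Longrightarrow>
      monoid \<lparr>carrier = elts C c, mult = tensor L C c, one = unit_elt L C c\<rparr>"
    and qnt_one: "q \<in> Quants L \<Longrightarrow> b \<in> Ob C \<Longrightarrow> x \<in> elts C b \<Longrightarrow>
      Qnt C q b (one_ob C) (Pull C (proj1 C b (one_ob C)) x) = x"
    and qnt_times: "q \<in> Quants L \<Longrightarrow> b \<in> Ob C \<Longrightarrow> c \<in> Ob C \<Longrightarrow> d \<in> Ob C \<Longrightarrow>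
      x \<in> elts C (times_ob C (times_ob C b c) d) \<Longrightarrow>
      Qnt C q b (times_ob C c d) (Pull C (assoc_arr C b c d) x) =
        Qnt C q b c (Qnt C q (times_ob C b c) d x)"
    and eql_one: "Eql C (one_ob C) = unit_elt L C (times_ob C (one_ob C) (one_ob C))"
    and eql_times: "b \<in> Ob C \<Longrightarrow> c \<in> Ob C \<Longrightarrow>
      (let bc = times_ob C b c; p = proj1 C bc bc; q = proj2 C bc bc
       in Eql C bc = tensor L C (times_ob C bc bc)
            (Pull C (pair C (Cmp C (proj1 C b c) p) (Cmp C (proj1 C b c) q)) (Eql C b))
            (Pull C (pair C (Cmp C (proj2 C b c) p) (Cmp C (proj2 C b c) q)) (Eql C c)))"


section \<open>Structures and models\<close>

record ('s, 'f, 'r, 'o, 'm, 'p) struc =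
  sort_int :: "'s \<Rightarrow> 'o"
  fun_int :: "'f \<Rightarrow> 'm"
  rel_int :: "'r \<Rightarrow> 'p"

definition sorts_int ::
  "('o, 'm, 'p, 'k, 'q) fa \<Rightarrow> ('s, 'f, 'r, 'o, 'm, 'p) struc \<Rightarrow> 's list \<Rightarrow> 'o" where
  "sorts_int C S \<sigma>s = Prd C (map (sort_int S) \<sigma>s)"

definition is_structure ::
  "('s, 'f, 'r) sig \<Rightarrow> ('o, 'm, 'p, 'k, 'q) fa \<Rightarrow> ('s, 'f, 'r, 'o, 'm, 'p) struc \<Rightarrow> bool" where
  "is_structure Sg C S \<longleftrightarrow>
     (\<forall>\<sigma> \<in> Sorts Sg. sort_int S \<sigma> \<in> Ob C) \<and>
     (\<forall>f \<in> Funs Sg. fun_int S f \<in>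
        hom_set C (sorts_int C S (fun_dom Sg f)) (sort_int S (fun_cod Sg f))) \<and>
     (\<forall>R \<in> Rels Sg. rel_int S R \<in> elts C (sorts_int C S (rel_dom Sg R)))"

definition ctx_int ::
  "('o, 'm, 'p, 'k, 'q) fa \<Rightarrow> ('s, 'f, 'r, 'o, 'm, 'p) struc \<Rightarrow> ('v, 's) ctx \<Rightarrow> 'o" where
  "ctx_int C S \<Gamma> = sorts_int C S (map snd \<Gamma>)"

definition ctx_proj ::
  "('o, 'm, 'p, 'k, 'q) fa \<Rightarrow> ('s, 'f, 'r, 'o, 'm, 'p) struc \<Rightarrow> ('v, 's) ctx \<Rightarrow> 'm list" where
  "ctx_proj C S \<Gamma> = Prj C (map (sort_int S) (map snd \<Gamma>))"

definition var_index :: "('v, 's) ctx \<Rightarrow> 'v \<Rightarrow> nat" where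
  "var_index \<Gamma> x = (THE i. i < length \<Gamma> \<and> fst (\<Gamma> ! i) = x)"

primrec tm_int ::
  "('o, 'm, 'p, 'k, 'q) fa \<Rightarrow> ('s, 'f, 'r, 'o, 'm, 'p) struc \<Rightarrow> ('v, 's) ctx \<Rightarrow> ('f, 'v) tm \<Rightarrow> 'm"
where
  "tm_int C S \<Gamma> (Var x) = ctx_proj C S \<Gamma> ! var_index \<Gamma> x"
| "tm_int C S \<Gamma> (Fn f Ms) = Cmp C (fun_int S f) (tuple C (ctx_int C S \<Gamma>) (map (tm_int C S \<Gamma>) Ms))"

definition ctx_ext_arr ::
  "('o, 'm, 'p, 'k, 'q) fa \<Rightarrow> ('s, 'f, 'r, 'o, 'm, 'p) struc \<Rightarrow> ('v, 's) ctx \<Rightarrow> 's \<Rightarrow> 'm" where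
  "ctx_ext_arr C S \<Gamma> \<sigma> =
     (let g = ctx_int C S \<Gamma>; s = sort_int S \<sigma>
      in tuple C (times_ob C g s)
           (map (\<lambda>p. Cmp C p (proj1 C g s)) (ctx_proj C S \<Gamma>) @ [proj2 C g s]))"

fun fm_int ::
  "('o, 'm, 'p, 'k, 'q) fa \<Rightarrow> ('s, 'f, 'r, 'o, 'm, 'p) struc \<Rightarrow> ('v, 's) ctx \<Rightarrow>
   ('s, 'f, 'r, 'k, 'q, 'v) fm \<Rightarrow> 'p"
where
  "fm_int C S \<Gamma> (Rel R Ms) =
     Pull C (tuple C (ctx_int C S \<Gamma>) (map (tm_int C S \<Gamma>) Ms)) (rel_int S R)"
| "fm_int C S \<Gamma> (Equal \<sigma> M N) =
     Pull C (pair C (tm_int C S \<Gamma> M) (tm_int C S \<Gamma> N)) (Eql C (sort_int S \<sigma>))"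
| "fm_int C S \<Gamma> (Conn k \<phi>s) = Con C (ctx_int C S \<Gamma>) k (map (fm_int C S \<Gamma>) \<phi>s)"
| "fm_int C S \<Gamma> (Quant q x \<sigma> \<phi>) =
     Qnt C q (ctx_int C S \<Gamma>) (sort_int S \<sigma>)
       (Pull C (ctx_ext_arr C S \<Gamma> \<sigma>) (fm_int C S (\<Gamma> @ [(x, \<sigma>)]) \<phi>))"

fun tensor_list ::
  "('k, 'q) lang \<Rightarrow> ('o, 'm, 'p, 'k, 'q) fa \<Rightarrow> 'o \<Rightarrow> 'p list \<Rightarrow> 'p" where
  "tensor_list L C c [] = unit_elt L C c"
| "tensor_list L C c [x] = x"
| "tensor_list L C c (x # y # ys) = tensor L C c x (tensor_list L C c (y # ys))"

fun satisfies ::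
  "('k, 'q) lang \<Rightarrow> ('o, 'm, 'p, 'k, 'q) fa \<Rightarrow> ('s, 'f, 'r, 'o, 'm, 'p) struc \<Rightarrow>
   ('s, 'f, 'r, 'k, 'q, 'v) assertion \<Rightarrow> bool"
where
  "satisfies L C S (Equation \<Gamma> \<tau> M N) \<longleftrightarrow> tm_int C S \<Gamma> M = tm_int C S \<Gamma> N"
| "satisfies L C S (Sequent \<Gamma> \<phi>s \<phi>) \<longleftrightarrow>
     tensor_list L C (ctx_int C S \<Gamma>) (map (fm_int C S \<Gamma>) \<phi>s)
       \<sqsubseteq>\<^bsub>Fib C (ctx_int C S \<Gamma>)\<^esub> fm_int C S \<Gamma> \<phi>"

definition is_model ::
  "('k, 'q) lang \<Rightarrow> ('s, 'f, 'r) sig \<Rightarrow> ('s, 'f, 'r, 'k, 'q, 'v) assertion set \<Rightarrow>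
   ('o, 'm, 'p, 'k, 'q) fa \<Rightarrow> ('s, 'f, 'r, 'o, 'm, 'p) struc \<Rightarrow> bool"
where
  "is_model L Sg T C S \<longleftrightarrow> is_structure Sg C S \<and> (\<forall>A \<in> T. satisfies L C S A)"


section \<open>Morphisms of FA and the image of a structure\<close>

record ('o1, 'm1, 'p1, 'o2, 'm2, 'p2) fa_map =
  ob_map :: "'o1 \<Rightarrow> 'o2"
  arr_map :: "'m1 \<Rightarrow> 'm2"
  elt_map :: "'o1 \<Rightarrow> 'p1 \<Rightarrow> 'p2"

definition prod_comparison ::
  "('o1, 'm1, 'p1, 'k, 'q) fa \<Rightarrow> ('o2, 'm2, 'p2, 'k, 'q) fa \<Rightarrow>
   ('o1, 'm1, 'p1, 'o2, 'm2, 'p2) fa_map \<Rightarrow> 'o1 list \<Rightarrow> 'm2"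
where
  "prod_comparison C D F cs = tuple D (ob_map F (Prd C cs)) (map (arr_map F) (Prj C cs))"

locale fa_morphism = C: fa_object L C + D: fa_object L D
  for L :: "('k, 'q) lang"
    and C :: "('o1, 'm1, 'p1, 'k, 'q) fa"
    and D :: "('o2, 'm2, 'p2, 'k, 'q) fa" +
  fixes F :: "('o1, 'm1, 'p1, 'o2, 'm2, 'p2) fa_map"
  assumes ob_map: "c \<in> Ob C \<Longrightarrow> ob_map F c \<in> Ob D"
    and arr_map: "f \<in> hom_set C b c \<Longrightarrow> arr_map F f \<in> hom_set D (ob_map F b) (ob_map F c)"
    and arr_map_ide: "c \<in> Ob C \<Longrightarrow> arr_map F (Ide C c) = Ide D (ob_map F c)"
    and arr_map_cmp: "f \<in> hom_set C a b \<Longrightarrow> g \<in> hom_set C b c \<Longrightarrow>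
      arr_map F (Cmp C g f) = Cmp D (arr_map F g) (arr_map F f)"
    and preserves_products: "is_product C cs p ps \<Longrightarrow>
      is_product D (map (ob_map F) cs) (ob_map F p) (map (arr_map F) ps)"
    and elt_map: "c \<in> Ob C \<Longrightarrow> elt_map F c \<in> elts C c \<rightarrow> elts D (ob_map F c)"
    and elt_map_mono: "c \<in> Ob C \<Longrightarrow> isotone (Fib C c) (Fib D (ob_map F c)) (elt_map F c)"
    and elt_map_natural: "f \<in> hom_set C b c \<Longrightarrow> x \<in> elts C c \<Longrightarrow>
      elt_map F b (Pull C f x) = Pull D (arr_map F f) (elt_map F c x)"
    and elt_map_con: "c \<in> Ob C \<Longrightarrow> k \<in> conns_of_arity L (length xs) \<Longrightarrow> set xs \<subseteq> elts C c \<Longrightarrow>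
      elt_map F c (Con C c k xs) = Con D (ob_map F c) k (map (elt_map F c) xs)"
    and elt_map_qnt: "q \<in> Quants L \<Longrightarrow> b \<in> Ob C \<Longrightarrow> c \<in> Ob C \<Longrightarrow>
      x \<in> elts C (times_ob C b c) \<Longrightarrow>
      elt_map F b (Qnt C q b c x) =
        Qnt D q (ob_map F b) (ob_map F c)
          (Pull D (inverse_arr D (prod_comparison C D F [b, c])) (elt_map F (times_ob C b c) x))"
    and elt_map_eql: "c \<in> Ob C \<Longrightarrow>
      elt_map F (times_ob C c c) (Eql C c) =
        Pull D (prod_comparison C D F [c, c]) (Eql D (ob_map F c))"

definition image_struc ::
  "('s, 'f, 'r) sig \<Rightarrow> ('o1, 'm1, 'p1, 'k, 'q) fa \<Rightarrow> ('o2, 'm2, 'p2, 'k, 'q) fa \<Rightarrow>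
   ('o1, 'm1, 'p1, 'o2, 'm2, 'p2) fa_map \<Rightarrow>
   ('s, 'f, 'r, 'o1, 'm1, 'p1) struc \<Rightarrow> ('s, 'f, 'r, 'o2, 'm2, 'p2) struc"
where
  "image_struc Sg C D F S =
     (let a = (\<lambda>\<sigma>s. prod_comparison C D F (map (sort_int S) \<sigma>s))
      in \<lparr>sort_int = (\<lambda>\<sigma>. ob_map F (sort_int S \<sigma>)),
          fun_int = (\<lambda>f. Cmp D (arr_map F (fun_int S f)) (inverse_arr D (a (fun_dom Sg f)))),
          rel_int = (\<lambda>R. Pull D (inverse_arr D (a (rel_dom Sg R)))
            (elt_map F (sorts_int C S (rel_dom Sg R)) (rel_int S R)))\<rparr>)"

end

theory Submission
  imports Defs
begin

text \<open>The canonical isomorphisms \<open>a\<^sub>\<Gamma>\<close> relate the two interpretations: by induction on terms,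
  \<open>F\<lbrakk>M\<rbrakk> = \<lbrakk>M\<rbrakk> \<circ> a\<^sub>\<Gamma>\<close>, and by induction on formulas, \<open>F\<lbrakk>\<phi>\<rbrakk> = Q(a\<^sub>\<Gamma>)\<lbrakk>\<phi>\<rbrakk>\<close>, where the right-hand
  sides are interpreted in \<open>F(S)\<close>. Since \<open>a\<^sub>\<Gamma>\<close> is invertible and \<open>F\<^sup>p\<close> and \<open>Q(a\<^sub>\<Gamma>\<^sup>-\<^sup>1)\<close> are monotone,
  equations and sequents that hold in \<open>S\<close> hold in \<open>F(S)\<close>.\<close>

section \<open>Tuples and products\<close>

lemma is_cone_iff_nth:
  "is_cone C cs x fs \<longleftrightarrow> x \<in> Ob C \<and> set cs \<subseteq> Ob C \<and> length fs = length cs \<and>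
     (\<forall>i < length cs. fs ! i \<in> hom_set C x (cs ! i))"
  by (auto simp: is_cone_def list_all2_conv_all_nth)

text \<open>\<open>tuple\<close> reads its list of factors off the codomains of the components; for
  a cone this recovers the intended list \<open>cs\<close>.\<close>

lemma is_cone_cod: "is_cone C cs x fs \<Longrightarrow> map (Cod C) fs = cs"
  by (auto simp: is_cone_iff_nth hom_set_def intro: nth_equalityI)

lemma is_cone_arr: "is_cone C cs x fs \<Longrightarrow> f \<in> set fs \<Longrightarrow> f \<in> hom_set C x (Cod C f)"
  by (auto simp: is_cone_iff_nth hom_set_def in_set_conv_nth)

context category
begin

lemma hom_obs: "f \<in> hom_set C a b \<Longrightarrow> a \<in> Ob C" "f \<in> hom_set C a b \<Longrightarrow> b \<in> Ob C"
  using dom_in_Ob cod_in_Ob by (auto simp: hom_set_def)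

lemma is_cone_cmp:
  "is_cone C cs x fs \<Longrightarrow> h \<in> hom_set C y x \<Longrightarrow> is_cone C cs y (map (\<lambda>f. Cmp C f h) fs)"
  by (simp add: is_cone_iff_nth hom_obs(1)[of h y x] cmp_in_hom[of h y x])

text \<open>\<open>inverse_arr\<close> is a definite description, so uniqueness has to be shown
  first: any left inverse h of f satisfies h = h(fg) = (hf)g = g.\<close>

lemma inverse_arr_eqI:
  assumes f: "f \<in> hom_set C a b" and g: "g \<in> hom_set C b a"
    and gf: "Cmp C g f = Ide C a" and fg: "Cmp C f g = Ide C b"
  shows "inverse_arr C f = g"
proof -
  have ab: "Dom C f = a" "Cod C f = b"
    using f by (auto simp: hom_set_def)
  have "h = g" if h: "h \<in> hom_set C b a" "Cmp C h f = Ide C a" for h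
    using cmp_assoc[OF g f h(1)] by (simp add: h(2) fg cmp_ide[OF h(1)] ide_cmp[OF g])
  then show ?thesis
    unfolding inverse_arr_def ab using g gf fg by blast
qed

end

context product_category
begin

lemma Prj_cone: "set cs \<subseteq> Ob C \<Longrightarrow> is_cone C cs (Prd C cs) (Prj C cs)"
  using designated_product by (auto simp: is_product_def)

lemma Prd_in_Ob: "set cs \<subseteq> Ob C \<Longrightarrow> Prd C cs \<in> Ob C"
  using Prj_cone by (auto simp: is_cone_def)

lemma length_Prj: "set cs \<subseteq> Ob C \<Longrightarrow> length (Prj C cs) = length cs"
  using Prj_cone by (auto simp: is_cone_iff_nth)

lemma Prj_in_hom:
  "set cs \<subseteq> Ob C \<Longrightarrow> i < length cs \<Longrightarrow> Prj C cs ! i \<in> hom_set C (Prd C cs) (cs ! i)"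
  using Prj_cone by (auto simp: is_cone_iff_nth)

text \<open>The first part makes the description in the second part denote the mediating
  arrow.\<close>

lemma tuple_universal:
  assumes "is_cone C cs x fs"
  shows "\<exists>!h. h \<in> hom_set C x (Prd C cs) \<and> map (\<lambda>q. Cmp C q h) (Prj C cs) = fs"
    and "tuple C x fs = (THE h. h \<in> hom_set C x (Prd C cs) \<and> map (\<lambda>q. Cmp C q h) (Prj C cs) = fs)"
proof -
  have "set cs \<subseteq> Ob C"
    using assms by (simp add: is_cone_def)
  then show "\<exists>!h. h \<in> hom_set C x (Prd C cs) \<and> map (\<lambda>q. Cmp C q h) (Prj C cs) = fs"
    using designated_product assms unfolding is_product_def by blast
  show "tuple C x fs = (THE h. h \<in> hom_set C x (Prd C cs) \<and> map (\<lambda>q. Cmp C q h) (Prj C cs) = fs)"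
    unfolding tuple_def is_cone_cod[OF assms] ..
qed

lemma tuple_in_hom: "is_cone C cs x fs \<Longrightarrow> tuple C x fs \<in> hom_set C x (Prd C cs)"
  and Prj_tuple: "is_cone C cs x fs \<Longrightarrow> map (\<lambda>q. Cmp C q (tuple C x fs)) (Prj C cs) = fs"
  using theI'[OF tuple_universal(1)] by (simp_all add: tuple_universal(2))

lemma Prj_tuple_nth:
  "is_cone C cs x fs \<Longrightarrow> i < length cs \<Longrightarrow> Cmp C (Prj C cs ! i) (tuple C x fs) = fs ! i"
  using Prj_tuple[of cs x fs] length_Prj[of cs]
  by (metis is_cone_def nth_map)

lemma tuple_eqI:
  "is_cone C cs x fs \<Longrightarrow> h \<in> hom_set C x (Prd C cs) \<Longrightarrow> map (\<lambda>q. Cmp C q h) (Prj C cs) = fs \<Longrightarrow>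
    tuple C x fs = h"
  using tuple_universal(1) tuple_in_hom Prj_tuple by blast

text \<open>Both arrows have the same composites with the designated projections, so the uniqueness
  half of the universal property identifies them.\<close>

lemma tuple_cmp:
  assumes fs: "is_cone C cs x fs" and h: "h \<in> hom_set C y x"
  shows "Cmp C (tuple C x fs) h = tuple C y (map (\<lambda>f. Cmp C f h) fs)"
proof (rule sym, rule tuple_eqI[OF is_cone_cmp[OF fs h]])
  have cs: "set cs \<subseteq> Ob C"
    using fs by (simp add: is_cone_def)
  note t = tuple_in_hom[OF fs]
  show "Cmp C (tuple C x fs) h \<in> hom_set C y (Prd C cs)"
    using cmp_in_hom[OF h t] .
  show "map (\<lambda>q. Cmp C q (Cmp C (tuple C x fs) h)) (Prj C cs) = map (\<lambda>f. Cmp C f h) fs"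
  proof (rule nth_equalityI)
    show "length (map (\<lambda>q. Cmp C q (Cmp C (tuple C x fs) h)) (Prj C cs)) =
        length (map (\<lambda>f. Cmp C f h) fs)"
      using fs cs by (simp add: length_Prj is_cone_iff_nth)
  next
    fix i
    assume "i < length (map (\<lambda>q. Cmp C q (Cmp C (tuple C x fs) h)) (Prj C cs))"
    then have i: "i < length cs" and i': "i < length (Prj C cs)" "i < length fs"
      using fs cs by (auto simp: length_Prj is_cone_iff_nth)
    show "map (\<lambda>q. Cmp C q (Cmp C (tuple C x fs) h)) (Prj C cs) ! i =
        map (\<lambda>f. Cmp C f h) fs ! i"
      using i' cmp_assoc[OF h t Prj_in_hom[OF cs i]] Prj_tuple_nth[OF fs i] by simp
  qed
qed

lemma tuple_Prj: "set cs \<subseteq> Ob C \<Longrightarrow> tuple C (Prd C cs) (Prj C cs) = Ide C (Prd C cs)"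
proof (rule tuple_eqI[OF Prj_cone])
  assume cs: "set cs \<subseteq> Ob C"
  show "Ide C (Prd C cs) \<in> hom_set C (Prd C cs) (Prd C cs)"
    using cs by (simp add: Prd_in_Ob ide_in_hom)
  show "map (\<lambda>q. Cmp C q (Ide C (Prd C cs))) (Prj C cs) = Prj C cs"
    using is_cone_arr[OF Prj_cone[OF cs]] by (auto intro!: map_idI cmp_ide)
qed

text \<open>Two products of the same list are isomorphic. Applied to the image under a functor of a
  designated product, this makes the comparison arrow invertible.\<close>

lemma tuple_of_product_invertible:
  assumes p: "is_product C cs p ps"
  obtains g where "g \<in> hom_set C (Prd C cs) p"
    and "Cmp C g (tuple C p ps) = Ide C p" and "Cmp C (tuple C p ps) g = Ide C (Prd C cs)"
proof -
  have ps: "is_cone C cs p ps" and p_Ob: "p \<in> Ob C" and cs: "set cs \<subseteq> Ob C"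
    using p by (auto simp: is_product_def is_cone_def)
  note t = tuple_in_hom[OF ps]
  \<comment> \<open>The candidate inverse is the arrow that the universal property of
    \<open>p\<close> assigns to the designated projections.\<close>
  obtain g where g: "g \<in> hom_set C (Prd C cs) p" and ps_g: "map (\<lambda>q. Cmp C q g) ps = Prj C cs"
    using p Prj_cone[OF cs] unfolding is_product_def by blast
  have tg: "Cmp C (tuple C p ps) g = Ide C (Prd C cs)"
    using tuple_cmp[OF ps g] by (simp add: ps_g tuple_Prj cs)
  \<comment> \<open>Both \<open>Cmp C g (tuple C p ps)\<close> and the identity of \<open>p\<close>
    turn out to mediate the cone \<open>ps\<close> through itself; uniqueness at \<open>p\<close>
    makes them equal.\<close>
  have "map (\<lambda>q. Cmp C q (Cmp C g (tuple C p ps))) ps =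
      map (\<lambda>q. Cmp C q (tuple C p ps)) (map (\<lambda>q. Cmp C q g) ps)"
    by (simp add: cmp_assoc[OF t g is_cone_arr[OF ps]])
  then have "map (\<lambda>q. Cmp C q (Cmp C g (tuple C p ps))) ps = ps"
    by (simp only: ps_g Prj_tuple[OF ps])
  moreover have "map (\<lambda>q. Cmp C q (Ide C p)) ps = ps"
    using is_cone_arr[OF ps] by (auto intro!: map_idI cmp_ide)
  moreover have "\<exists>!h. h \<in> hom_set C p p \<and> map (\<lambda>q. Cmp C q h) ps = ps"
    using p ps unfolding is_product_def by blast
  ultimately have "Cmp C g (tuple C p ps) = Ide C p"
    using cmp_in_hom[OF t g] ide_in_hom[OF p_Ob] by blast
  with g tg that show ?thesis by blast
qed

section \<open>Binary products and pairing\<close>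

lemma times_ob_in_Ob: "b \<in> Ob C \<Longrightarrow> c \<in> Ob C \<Longrightarrow> times_ob C b c \<in> Ob C"
  by (simp add: times_ob_def Prd_in_Ob)

lemma proj1_in_hom: "b \<in> Ob C \<Longrightarrow> c \<in> Ob C \<Longrightarrow> proj1 C b c \<in> hom_set C (times_ob C b c) b"
  using Prj_in_hom[of "[b, c]" 0] by (simp add: times_ob_def proj1_def)

lemma proj2_in_hom: "b \<in> Ob C \<Longrightarrow> c \<in> Ob C \<Longrightarrow> proj2 C b c \<in> hom_set C (times_ob C b c) c"
  using Prj_in_hom[of "[b, c]" 1] by (simp add: times_ob_def proj2_def)

lemma Prj_binary: "b \<in> Ob C \<Longrightarrow> c \<in> Ob C \<Longrightarrow> Prj C [b, c] = [proj1 C b c, proj2 C b c]"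
  using length_Prj[of "[b, c]"] by (auto simp: proj1_def proj2_def length_Suc_conv)

lemma is_cone_binary:
  "f \<in> hom_set C x b \<Longrightarrow> g \<in> hom_set C x c \<Longrightarrow> is_cone C [b, c] x [f, g]"
  using hom_obs by (auto simp: is_cone_def)

lemma pair_eq_tuple: "f \<in> hom_set C x b \<Longrightarrow> pair C f g = tuple C x [f, g]"
  by (auto simp: pair_def hom_set_def)

lemma pair_in_hom:
  "f \<in> hom_set C x b \<Longrightarrow> g \<in> hom_set C x c \<Longrightarrow> pair C f g \<in> hom_set C x (times_ob C b c)"
  using tuple_in_hom[OF is_cone_binary] by (simp add: pair_eq_tuple times_ob_def)

lemma pair_cmp:
  "f \<in> hom_set C x b \<Longrightarrow> g \<in> hom_set C x c \<Longrightarrow> h \<in> hom_set C y x \<Longrightarrow>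
    Cmp C (pair C f g) h = pair C (Cmp C f h) (Cmp C g h)"
  using tuple_cmp[OF is_cone_binary, of f x b g c h y] cmp_in_hom[of h y x f b]
  by (simp add: pair_eq_tuple)

lemma proj1_pair:
  "f \<in> hom_set C x b \<Longrightarrow> g \<in> hom_set C x c \<Longrightarrow> Cmp C (proj1 C b c) (pair C f g) = f"
  using Prj_tuple_nth[OF is_cone_binary, of f x b g c 0] by (simp add: pair_eq_tuple proj1_def)

lemma proj2_pair:
  "f \<in> hom_set C x b \<Longrightarrow> g \<in> hom_set C x c \<Longrightarrow> Cmp C (proj2 C b c) (pair C f g) = g"
  using Prj_tuple_nth[OF is_cone_binary, of f x b g c 1] by (simp add: pair_eq_tuple proj2_def)

lemma times_ide_in_hom:
  "f \<in> hom_set C a b \<Longrightarrow> c \<in> Ob C \<Longrightarrow>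
    times_ide C f c \<in> hom_set C (times_ob C a c) (times_ob C b c)"
  using pair_in_hom[OF cmp_in_hom[OF proj1_in_hom] proj2_in_hom, of a c f b] hom_obs(1)[of f a b]
  by (simp add: times_ide_def hom_set_def[of C a b])

text \<open>Used to compute the arrow occurring in the naturality condition for quantifiers once it
  is composed with a binary comparison, which is itself a pair.\<close>

lemma times_ide_pair:
  assumes f: "f \<in> hom_set C a b" and g: "g \<in> hom_set C x a" and h: "h \<in> hom_set C x c"
  shows "Cmp C (times_ide C f c) (pair C g h) = pair C (Cmp C f g) h"
proof -
  have a: "a \<in> Ob C" "c \<in> Ob C" "Dom C f = a"
    using f hom_obs(1)[OF f] hom_obs(2)[OF h] by (auto simp: hom_set_def)
  note p = proj1_in_hom[OF a(1,2)] and q = proj2_in_hom[OF a(1,2)]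
  show ?thesis
    unfolding times_ide_def a(3)
    by (simp add: pair_cmp[OF cmp_in_hom[OF p f] q pair_in_hom[OF g h]]
        cmp_assoc[OF pair_in_hom[OF g h] p f] proj1_pair[OF g h] proj2_pair[OF g h])
qed

end

section \<open>Interpretations of terms and formulas\<close>

context fa_object
begin

lemma unit_elt_in_elts: "c \<in> Ob C \<Longrightarrow> unit_elt L C c \<in> elts C c"
  using con_elts[of c "unit_con L" "[]"] unit_con by (simp add: unit_elt_def)

lemma tensor_in_elts:
  "c \<in> Ob C \<Longrightarrow> x \<in> elts C c \<Longrightarrow> y \<in> elts C c \<Longrightarrow> tensor L C c x y \<in> elts C c"
  using con_elts[of c "tensor_con L" "[x, y]"] tensor_con by (simp add: tensor_def numeral_2_eq_2)

text \<open>\<open>tensor_list\<close> treats singletons apart, so that no unit is appended; the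
  induction rule follows its three clauses.\<close>

lemma tensor_list_in_elts:
  "c \<in> Ob C \<Longrightarrow> set xs \<subseteq> elts C c \<Longrightarrow> tensor_list L C c xs \<in> elts C c"
  by (induction xs rule: induct_list012) (simp_all add: unit_elt_in_elts tensor_in_elts)

lemma Pull_in_elts: "f \<in> hom_set C b c \<Longrightarrow> x \<in> elts C c \<Longrightarrow> Pull C f x \<in> elts C b"
  using pull_elts by (auto simp: Pi_iff)

lemma Qnt_in_elts:
  "q \<in> Quants L \<Longrightarrow> b \<in> Ob C \<Longrightarrow> c \<in> Ob C \<Longrightarrow> x \<in> elts C (times_ob C b c) \<Longrightarrow>
    Qnt C q b c x \<in> elts C b"
  using qnt_elts by (auto simp: Pi_iff)

end

text \<open>The map \<open>h\<close> and the two FA-objects are left general, since this is applied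
  both to pullback within one object and to \<open>elt_map F c\<close> between two.\<close>

lemma tensor_list_hom:
  assumes "h (unit_elt L C c) = unit_elt L D d"
    and "\<And>x y. x \<in> elts C c \<Longrightarrow> y \<in> elts C c \<Longrightarrow> h (tensor L C c x y) = tensor L D d (h x) (h y)"
    and "fa_object L C" "c \<in> Ob C" "set xs \<subseteq> elts C c"
  shows "h (tensor_list L C c xs) = tensor_list L D d (map h xs)"
  using assms(5)
proof (induction xs rule: induct_list012)
  case (3 x y ys)
  \<comment> \<open>\<open>h\<close> is known to commute with the tensor only on elements of the
    fibre, so the tensor of the tail must first be placed there.\<close>
  moreover have "tensor_list L C c (y # ys) \<in> elts C c"
    using 3 assms(3,4) by (intro fa_object.tensor_list_in_elts) auto
  ultimately show ?case
    using assms(2) by simp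
qed (simp_all add: assms(1))

lemma (in fa_object) pull_tensor_list:
  assumes f: "f \<in> hom_set C b c" and xs: "set xs \<subseteq> elts C c"
  shows "Pull C f (tensor_list L C c xs) = tensor_list L C b (map (Pull C f) xs)"
proof (rule tensor_list_hom[OF _ _ fa_object_axioms hom_obs(2)[OF f] xs])
  \<comment> \<open>Unit and tensor are a nullary and a binary connective, so both goals are
    instances of the preservation of connectives.\<close>
  show "Pull C f (unit_elt L C c) = unit_elt L C b"
    using pull_con[OF f, of "unit_con L" "[]"] unit_con by (simp add: unit_elt_def)
  show "Pull C f (tensor L C c x y) = tensor L C b (Pull C f x) (Pull C f y)"
    if "x \<in> elts C c" "y \<in> elts C c" for x y
    using pull_con[OF f, of "tensor_con L" "[x, y]"] tensor_con that
    by (simp add: tensor_def numeral_2_eq_2)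
qed

text \<open>Distinctness of the variable names makes the position of \<open>x\<close> unique, hence
  the description in \<open>var_index\<close> well defined.\<close>

lemma var_index_nth:
  assumes "distinct (map fst \<Gamma>)" and "(x, \<sigma>) \<in> set \<Gamma>"
  shows "var_index \<Gamma> x < length \<Gamma>" and "\<Gamma> ! var_index \<Gamma> x = (x, \<sigma>)"
proof -
  obtain i where i: "i < length \<Gamma>" "\<Gamma> ! i = (x, \<sigma>)"
    using assms(2) by (auto simp: in_set_conv_nth)
  have uniq: "j = i" if "j < length \<Gamma>" "fst (\<Gamma> ! j) = x" for j
    using assms(1) i that nth_eq_iff_index_eq[of "map fst \<Gamma>" j i] by simp
  have "var_index \<Gamma> x = i"
    unfolding var_index_def
  proof (rule the_equality)
    show "i < length \<Gamma> \<and> fst (\<Gamma> ! i) = x"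
      using i by simp
    show "j = i" if "j < length \<Gamma> \<and> fst (\<Gamma> ! j) = x" for j
      using that by (intro uniq) simp_all
  qed
  then show "var_index \<Gamma> x < length \<Gamma>" and "\<Gamma> ! var_index \<Gamma> x = (x, \<sigma>)"
    using i by auto
qed

section \<open>Well-typedness of interpretations in a structure\<close>

locale fa_structure = fa_object L C + signature Sg
  for L :: "('k, 'q) lang"
    and C :: "('o, 'm, 'p, 'k, 'q) fa"
    and Sg :: "('s, 'f, 'r) sig" +
  fixes S :: "('s, 'f, 'r, 'o, 'm, 'p) struc"
  assumes is_structure: "is_structure Sg C S"
begin

lemma sort_int_in_Ob: "\<sigma> \<in> Sorts Sg \<Longrightarrow> sort_int S \<sigma> \<in> Ob C"
  using is_structure by (simp add: is_structure_def)

lemma sorts_in_Ob: "set \<sigma>s \<subseteq> Sorts Sg \<Longrightarrow> set (map (sort_int S) \<sigma>s) \<subseteq> Ob C"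
  using sort_int_in_Ob by auto

lemma ctx_sorts_in_Ob: "ctx_over Sg \<Gamma> \<Longrightarrow> set (map (sort_int S) (map snd \<Gamma>)) \<subseteq> Ob C"
  using sorts_in_Ob by (simp only: ctx_over_def)

lemma ctx_int_in_Ob: "ctx_over Sg \<Gamma> \<Longrightarrow> ctx_int C S \<Gamma> \<in> Ob C"
  using Prd_in_Ob[OF ctx_sorts_in_Ob] by (simp add: ctx_int_def sorts_int_def)

lemma fun_int_in_hom:
  "f \<in> Funs Sg \<Longrightarrow>
    fun_int S f \<in> hom_set C (Prd C (map (sort_int S) (fun_dom Sg f))) (sort_int S (fun_cod Sg f))"
  using is_structure by (simp add: is_structure_def sorts_int_def)

lemma rel_int_in_elts:
  "R \<in> Rels Sg \<Longrightarrow> rel_int S R \<in> elts C (Prd C (map (sort_int S) (rel_dom Sg R)))"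
  using is_structure by (simp add: is_structure_def sorts_int_def)

lemma ctx_proj_cone:
  "ctx_over Sg \<Gamma> \<Longrightarrow>
    is_cone C (map (sort_int S) (map snd \<Gamma>)) (ctx_int C S \<Gamma>) (ctx_proj C S \<Gamma>)"
  using Prj_cone[OF ctx_sorts_in_Ob] by (simp add: ctx_int_def sorts_int_def ctx_proj_def)

text \<open>The typing of the interpreted arguments is a hypothesis here because, in the induction
  on terms, it is exactly the induction hypothesis; \<open>tm_ints_cone\<close> is the version
  available afterwards.\<close>

lemma tms_int_cone:
  assumes "ctx_over Sg \<Gamma>" and "set \<sigma>s \<subseteq> Sorts Sg"
    and "list_all2 (\<lambda>M \<sigma>. tm_int C S \<Gamma> M \<in> hom_set C (ctx_int C S \<Gamma>) (sort_int S \<sigma>)) Ms \<sigma>s"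
  shows "is_cone C (map (sort_int S) \<sigma>s) (ctx_int C S \<Gamma>) (map (tm_int C S \<Gamma>) Ms)"
  using assms(3) unfolding is_cone_def
  by (intro conjI ctx_int_in_Ob assms(1) sorts_in_Ob assms(2)) (simp add: list_all2_map1 list_all2_map2)

lemma tm_int_in_hom:
  assumes \<Gamma>: "ctx_over Sg \<Gamma>" and M: "tm_in_ctx Sg \<Gamma> M \<sigma>"
  shows "tm_int C S \<Gamma> M \<in> hom_set C (ctx_int C S \<Gamma>) (sort_int S \<sigma>)"
  using M
proof induction
  case (Var x \<sigma>)
  have "distinct (map fst \<Gamma>)"
    using \<Gamma> by (simp add: ctx_over_def)
  note i = var_index_nth[OF this Var]
  have "\<forall>i < length \<Gamma>. ctx_proj C S \<Gamma> ! i \<in> hom_set C (ctx_int C S \<Gamma>) (sort_int S (snd (\<Gamma> ! i)))"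
    using ctx_proj_cone[OF \<Gamma>] by (simp add: is_cone_iff_nth)
  from this[rule_format, OF i(1)] show ?case
    by (simp add: i(2))
next
  case (Fn f Ms)
  have "list_all2 (\<lambda>M \<sigma>. tm_int C S \<Gamma> M \<in> hom_set C (ctx_int C S \<Gamma>) (sort_int S \<sigma>)) Ms (fun_dom Sg f)"
    using Fn(2) by (rule list_all2_mono) simp
  note Ms = tuple_in_hom[OF tms_int_cone[OF \<Gamma> fun_dom[OF Fn(1)] this]]
  show ?case
    using cmp_in_hom[OF Ms fun_int_in_hom[OF Fn(1)]] by (simp only: tm_int.simps)
qed

lemma tm_ints_cone:
  assumes "ctx_over Sg \<Gamma>" and "set \<sigma>s \<subseteq> Sorts Sg" and "list_all2 (tm_in_ctx Sg \<Gamma>) Ms \<sigma>s"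
  shows "is_cone C (map (sort_int S) \<sigma>s) (ctx_int C S \<Gamma>) (map (tm_int C S \<Gamma>) Ms)"
  by (rule tms_int_cone[OF assms(1,2) list_all2_mono[OF assms(3) tm_int_in_hom[OF assms(1)]]])

text \<open>These are the components of the canonical isomorphism from the binary product of
  \<open>g\<close> and \<open>s\<close> to the product of the extended context;
  \<open>ctx_ext_arr\<close> is their tuple.\<close>

lemma ctx_ext_cone:
  assumes "ctx_over Sg (\<Gamma> @ [(x, \<sigma>)])"
  defines "g \<equiv> ctx_int C S \<Gamma>" and "s \<equiv> sort_int S \<sigma>"
  shows "is_cone C (map (sort_int S) (map snd (\<Gamma> @ [(x, \<sigma>)]))) (times_ob C g s)
    (map (\<lambda>p. Cmp C p (proj1 C g s)) (ctx_proj C S \<Gamma>) @ [proj2 C g s])"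
proof -
  have \<Gamma>: "ctx_over Sg \<Gamma>" and "\<sigma> \<in> Sorts Sg"
    using assms(1) by (auto simp: ctx_over_def)
  then have gs: "g \<in> Ob C" "s \<in> Ob C"
    by (auto simp: g_def s_def ctx_int_in_Ob sort_int_in_Ob)
  then show ?thesis
    using is_cone_cmp[OF ctx_proj_cone[OF \<Gamma>, folded g_def] proj1_in_hom[OF gs]] proj2_in_hom[OF gs]
    by (auto simp: is_cone_def s_def intro: list_all2_appendI)
qed

lemma ctx_ext_arr_in_hom:
  "ctx_over Sg (\<Gamma> @ [(x, \<sigma>)]) \<Longrightarrow>
    ctx_ext_arr C S \<Gamma> \<sigma> \<in>
      hom_set C (times_ob C (ctx_int C S \<Gamma>) (sort_int S \<sigma>)) (ctx_int C S (\<Gamma> @ [(x, \<sigma>)]))"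
  using tuple_in_hom[OF ctx_ext_cone] by (simp add: ctx_ext_arr_def Let_def ctx_int_def sorts_int_def)

text \<open>For an equality formula this makes \<open>sort_int S \<sigma>\<close> an object, as
  \<open>eql_elts\<close> requires.\<close>

lemma tm_in_ctx_sort:
  assumes "ctx_over Sg \<Gamma>" "tm_in_ctx Sg \<Gamma> M \<sigma>" shows "\<sigma> \<in> Sorts Sg"
  using assms(2)
proof cases
  case (Var x)
  then show ?thesis using assms(1) by (force simp: ctx_over_def)
next
  case (Fn f Ms)
  then show ?thesis by (simp add: fun_cod)
qed

lemma fm_int_in_elts:
  assumes "fm_in_ctx L Sg \<Gamma> \<phi>" and "ctx_over Sg \<Gamma>"
  shows "fm_int C S \<Gamma> \<phi> \<in> elts C (ctx_int C S \<Gamma>)"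
  using assms
proof induction
  case (Rel R \<Gamma> Ms)
  then show ?case
    using Pull_in_elts[OF tuple_in_hom[OF tm_ints_cone] rel_int_in_elts] rel_dom by simp
next
  case (Equal \<Gamma> M \<sigma> N)
  then have "sort_int S \<sigma> \<in> Ob C"
    using sort_int_in_Ob tm_in_ctx_sort by blast
  with Equal show ?case
    using Pull_in_elts[OF pair_in_hom[OF tm_int_in_hom tm_int_in_hom] eql_elts] by simp
next
  case (Conn k \<phi>s \<Gamma>)
  then show ?case
    using con_elts[of "ctx_int C S \<Gamma>" k "map (fm_int C S \<Gamma>) \<phi>s"] by (auto simp: ctx_int_in_Ob)
next
  case (Quant q \<Gamma> x \<sigma> \<phi>)
  then have "\<sigma> \<in> Sorts Sg"
    by (simp add: ctx_over_def)
  with Quant(1,5) Pull_in_elts[OF ctx_ext_arr_in_hom[OF Quant(2)] Quant(4)[OF Quant(2)]]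
  show ?case
    by (simp add: Qnt_in_elts ctx_int_in_Ob sort_int_in_Ob)
qed

end

section \<open>Canonical comparison isomorphisms\<close>

context fa_morphism
begin

abbreviation comparison :: "'o1 list \<Rightarrow> 'm2" where
  "comparison cs \<equiv> prod_comparison C D F cs"

lemma is_cone_image:
  "is_cone C cs x fs \<Longrightarrow> is_cone D (map (ob_map F) cs) (ob_map F x) (map (arr_map F) fs)"
  using ob_map arr_map by (auto simp: is_cone_iff_nth)

lemma comparison_in_hom:
  "set cs \<subseteq> Ob C \<Longrightarrow>
    comparison cs \<in> hom_set D (ob_map F (Prd C cs)) (Prd D (map (ob_map F) cs))"
  unfolding prod_comparison_def by (intro D.tuple_in_hom is_cone_image C.Prj_cone)

text \<open>F sends the designated product to a product, and the comparison is the tuple of the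
  image projections, so it has a two-sided inverse; uniqueness identifies that inverse with
  \<open>inverse_arr\<close>.\<close>

lemma inverse_comparison:
  assumes "set cs \<subseteq> Ob C"
  shows "inverse_arr D (comparison cs) \<in> hom_set D (Prd D (map (ob_map F) cs)) (ob_map F (Prd C cs))"
    and "Cmp D (inverse_arr D (comparison cs)) (comparison cs) = Ide D (ob_map F (Prd C cs))"
    and "Cmp D (comparison cs) (inverse_arr D (comparison cs)) = Ide D (Prd D (map (ob_map F) cs))"
proof -
  obtain g where g: "g \<in> hom_set D (Prd D (map (ob_map F) cs)) (ob_map F (Prd C cs))"
    "Cmp D g (comparison cs) = Ide D (ob_map F (Prd C cs))"
    "Cmp D (comparison cs) g = Ide D (Prd D (map (ob_map F) cs))"
    by (rule D.tuple_of_product_invertible[OF preserves_products[OF C.designated_product[OF assms]],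
          folded prod_comparison_def])
  have "inverse_arr D (comparison cs) = g"
    by (rule D.inverse_arr_eqI[OF comparison_in_hom[OF assms] g])
  with g show
    "inverse_arr D (comparison cs) \<in> hom_set D (Prd D (map (ob_map F) cs)) (ob_map F (Prd C cs))"
    "Cmp D (inverse_arr D (comparison cs)) (comparison cs) = Ide D (ob_map F (Prd C cs))"
    "Cmp D (comparison cs) (inverse_arr D (comparison cs)) = Ide D (Prd D (map (ob_map F) cs))"
    by simp_all
qed

text \<open>An isomorphism is epi. This is what transfers equations from \<open>S\<close> to its
  image.\<close>

lemma comparison_cancel_right:
  assumes cs: "set cs \<subseteq> Ob C"
    and g: "g \<in> hom_set D (Prd D (map (ob_map F) cs)) d" "h \<in> hom_set D (Prd D (map (ob_map F) cs)) d"
    and "Cmp D g (comparison cs) = Cmp D h (comparison cs)"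
  shows "g = h"
proof -
  have retract: "Cmp D (Cmp D k (comparison cs)) (inverse_arr D (comparison cs)) = k"
    if "k \<in> hom_set D (Prd D (map (ob_map F) cs)) d" for k
    using D.cmp_assoc[OF inverse_comparison(1)[OF cs] comparison_in_hom[OF cs] that]
    by (simp add: inverse_comparison(3)[OF cs] D.cmp_ide[OF that])
  show ?thesis
    by (rule trans[OF sym[OF retract[OF g(1), unfolded assms(4)]] retract[OF g(2)]])
qed

text \<open>Solves an equation for \<open>g\<close>, producing the inverse comparison that is built
  into the function and relation symbols of the image structure.\<close>

lemma inverse_comparison_cmp_eq:
  assumes cs: "set cs \<subseteq> Ob C" and g: "g \<in> hom_set D d (ob_map F (Prd C cs))"
    and "Cmp D (comparison cs) g = h"
  shows "Cmp D (inverse_arr D (comparison cs)) h = g"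
  using D.cmp_assoc[OF g comparison_in_hom[OF cs] inverse_comparison(1)[OF cs]] assms(3)
  by (simp add: inverse_comparison(2)[OF cs] D.ide_cmp[OF g])

lemma Prj_comparison:
  "set cs \<subseteq> Ob C \<Longrightarrow> i < length cs \<Longrightarrow>
    Cmp D (Prj D (map (ob_map F) cs) ! i) (comparison cs) = arr_map F (Prj C cs ! i)"
  using D.Prj_tuple_nth[OF is_cone_image[OF C.Prj_cone], of cs i]
  by (simp add: prod_comparison_def C.length_Prj)

text \<open>The components of the comparison are the images of the projections, and by functoriality
  the image of a projection after the image of a tuple is the image of a component.\<close>

lemma comparison_tuple:
  assumes fs: "is_cone C cs x fs"
  shows "Cmp D (comparison cs) (arr_map F (tuple C x fs)) = tuple D (ob_map F x) (map (arr_map F) fs)"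
proof -
  have cs: "set cs \<subseteq> Ob C"
    using fs by (simp add: is_cone_def)
  note t = C.tuple_in_hom[OF fs]
  have "map (\<lambda>f. Cmp D f (arr_map F (tuple C x fs))) (map (arr_map F) (Prj C cs)) =
      map (arr_map F) (map (\<lambda>q. Cmp C q (tuple C x fs)) (Prj C cs))"
    by (simp add: arr_map_cmp[OF t is_cone_arr[OF C.Prj_cone[OF cs]]])
  then show ?thesis
    unfolding prod_comparison_def
    using D.tuple_cmp[OF is_cone_image[OF C.Prj_cone[OF cs]] arr_map[OF t]]
    by (simp add: C.Prj_tuple[OF fs])
qed

lemma comparison_binary:
  "b \<in> Ob C \<Longrightarrow> c \<in> Ob C \<Longrightarrow>
    comparison [b, c] = pair D (arr_map F (proj1 C b c)) (arr_map F (proj2 C b c))"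
  using D.pair_eq_tuple[OF arr_map[OF C.proj1_in_hom]]
  by (simp add: prod_comparison_def C.Prj_binary times_ob_def)

lemma comparison_pair:
  assumes "f \<in> hom_set C x b" "g \<in> hom_set C x c"
  shows "Cmp D (comparison [b, c]) (arr_map F (pair C f g)) = pair D (arr_map F f) (arr_map F g)"
  using comparison_tuple[OF C.is_cone_binary[OF assms]]
    D.pair_eq_tuple[OF arr_map[OF assms(1)]] C.pair_eq_tuple[OF assms(1)] by simp

lemma elt_map_in_elts: "c \<in> Ob C \<Longrightarrow> x \<in> elts C c \<Longrightarrow> elt_map F c x \<in> elts D (ob_map F c)"
  using elt_map by (auto simp: Pi_iff)

lemma elt_map_tensor_list:
  assumes c: "c \<in> Ob C" and xs: "set xs \<subseteq> elts C c"
  shows "elt_map F c (tensor_list L C c xs) = tensor_list L D (ob_map F c) (map (elt_map F c) xs)"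
proof (rule tensor_list_hom[OF _ _ C.fa_object_axioms c xs])
  show "elt_map F c (unit_elt L C c) = unit_elt L D (ob_map F c)"
    using elt_map_con[OF c, of "unit_con L" "[]"] C.unit_con by (simp add: unit_elt_def)
  show "elt_map F c (tensor L C c x y) = tensor L D (ob_map F c) (elt_map F c x) (elt_map F c y)"
    if "x \<in> elts C c" "y \<in> elts C c" for x y
    using elt_map_con[OF c, of "tensor_con L" "[x, y]"] C.tensor_con that
    by (simp add: tensor_def numeral_2_eq_2)
qed

end

section \<open>The image of a structure\<close>

locale fa_structure_image = fa_morphism L C D F + S: fa_structure L C Sg S
  for L :: "('k, 'q) lang"
    and C :: "('o1, 'm1, 'p1, 'k, 'q) fa"
    and D :: "('o2, 'm2, 'p2, 'k, 'q) fa"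
    and F :: "('o1, 'm1, 'p1, 'o2, 'm2, 'p2) fa_map"
    and Sg :: "('s, 'f, 'r) sig"
    and S :: "('s, 'f, 'r, 'o1, 'm1, 'p1) struc"
begin

abbreviation FS :: "('s, 'f, 'r, 'o2, 'm2, 'p2) struc" where
  "FS \<equiv> image_struc Sg C D F S"

text \<open>This is the isomorphism \<open>a\<^sub>\<Gamma>\<close>.\<close>

definition ctx_comparison :: "('v, 's) ctx \<Rightarrow> 'm2" where
  "ctx_comparison \<Gamma> = comparison (map (sort_int S) (map snd \<Gamma>))"

lemma sort_int_image: "sort_int FS \<sigma> = ob_map F (sort_int S \<sigma>)"
  by (simp add: image_struc_def Let_def)

text \<open>Keeps the two maps apart, as in the codomain of a comparison; the simplifier would fuse
  them by \<open>map_map\<close>, which later proofs therefore delete.\<close>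

lemma map_sort_int_image: "map (sort_int FS) \<sigma>s = map (ob_map F) (map (sort_int S) \<sigma>s)"
  by (simp add: sort_int_image)

lemma fun_int_image:
  "fun_int FS f =
    Cmp D (arr_map F (fun_int S f)) (inverse_arr D (comparison (map (sort_int S) (fun_dom Sg f))))"
  by (simp add: image_struc_def Let_def)

lemma rel_int_image:
  "rel_int FS R =
    Pull D (inverse_arr D (comparison (map (sort_int S) (rel_dom Sg R))))
      (elt_map F (Prd C (map (sort_int S) (rel_dom Sg R))) (rel_int S R))"
  by (simp add: image_struc_def Let_def sorts_int_def)

lemma is_structure_image: "is_structure Sg D FS"
  unfolding is_structure_def
proof (intro conjI ballI)
  fix \<sigma> assume "\<sigma> \<in> Sorts Sg"
  then show "sort_int FS \<sigma> \<in> Ob D"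
    by (simp add: sort_int_image ob_map S.sort_int_in_Ob)
next
  fix f assume f: "f \<in> Funs Sg"
  show "fun_int FS f \<in> hom_set D (sorts_int D FS (fun_dom Sg f)) (sort_int FS (fun_cod Sg f))"
    unfolding fun_int_image sorts_int_def map_sort_int_image sort_int_image
    by (intro D.cmp_in_hom[OF inverse_comparison(1) arr_map] S.sorts_in_Ob S.fun_dom
        S.fun_int_in_hom f)
next
  fix R assume R: "R \<in> Rels Sg"
  note cs = S.sorts_in_Ob[OF S.rel_dom[OF R]]
  show "rel_int FS R \<in> elts D (sorts_int D FS (rel_dom Sg R))"
    unfolding rel_int_image sorts_int_def map_sort_int_image
    by (intro D.Pull_in_elts[OF inverse_comparison(1)] elt_map_in_elts S.rel_int_in_elts
        C.Prd_in_Ob cs R)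
qed

text \<open>All typing results for structures now hold for \<open>FS\<close> too, under the prefix
  \<open>image\<close>.\<close>

sublocale image: fa_structure L D Sg FS
  by unfold_locales (rule is_structure_image)

lemma ctx_int_image: "ctx_int D FS \<Gamma> = Prd D (map (ob_map F) (map (sort_int S) (map snd \<Gamma>)))"
  by (simp add: ctx_int_def sorts_int_def map_sort_int_image del: map_map)

lemma ctx_comparison_in_hom:
  "ctx_over Sg \<Gamma> \<Longrightarrow>
    ctx_comparison \<Gamma> \<in> hom_set D (ob_map F (ctx_int C S \<Gamma>)) (ctx_int D FS \<Gamma>)"
  using comparison_in_hom[OF S.ctx_sorts_in_Ob]
  by (simp add: ctx_comparison_def ctx_int_image ctx_int_def[of C] sorts_int_def)

lemma ctx_proj_image:
  assumes "ctx_over Sg \<Gamma>"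
  shows "map (\<lambda>p. Cmp D p (ctx_comparison \<Gamma>)) (ctx_proj D FS \<Gamma>) = map (arr_map F) (ctx_proj C S \<Gamma>)"
  unfolding ctx_proj_def ctx_comparison_def map_sort_int_image prod_comparison_def
  by (rule D.Prj_tuple[OF is_cone_image[OF C.Prj_cone[OF S.ctx_sorts_in_Ob[OF assms]]]])

text \<open>The equation for single arguments is a hypothesis, so that this serves both inside the
  induction on terms and afterwards for relation symbols.\<close>

lemma tms_comparison:
  assumes \<Gamma>: "ctx_over Sg \<Gamma>" and \<sigma>s: "set \<sigma>s \<subseteq> Sorts Sg"
    and Ms: "list_all2 (tm_in_ctx Sg \<Gamma>) Ms \<sigma>s"
    and IH: "\<And>M. M \<in> set Ms \<Longrightarrow>
      arr_map F (tm_int C S \<Gamma> M) = Cmp D (tm_int D FS \<Gamma> M) (ctx_comparison \<Gamma>)"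
  shows "Cmp D (comparison (map (sort_int S) \<sigma>s))
      (arr_map F (tuple C (ctx_int C S \<Gamma>) (map (tm_int C S \<Gamma>) Ms))) =
    Cmp D (tuple D (ctx_int D FS \<Gamma>) (map (tm_int D FS \<Gamma>) Ms)) (ctx_comparison \<Gamma>)"
proof -
  have "map (arr_map F) (map (tm_int C S \<Gamma>) Ms) =
      map (\<lambda>f. Cmp D f (ctx_comparison \<Gamma>)) (map (tm_int D FS \<Gamma>) Ms)"
    using IH by simp
  then show ?thesis
    unfolding comparison_tuple[OF S.tm_ints_cone[OF \<Gamma> \<sigma>s Ms]]
      D.tuple_cmp[OF image.tm_ints_cone[OF \<Gamma> \<sigma>s Ms] ctx_comparison_in_hom[OF \<Gamma>]]
    by (rule arg_cong)
qed

lemma tm_int_image: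
  assumes \<Gamma>: "ctx_over Sg \<Gamma>" and M: "tm_in_ctx Sg \<Gamma> M \<sigma>"
  shows "arr_map F (tm_int C S \<Gamma> M) = Cmp D (tm_int D FS \<Gamma> M) (ctx_comparison \<Gamma>)"
  using M
proof induction
  case (Var x \<sigma>)
  have i: "var_index \<Gamma> x < length (map (sort_int S) (map snd \<Gamma>))"
    using \<Gamma> Var var_index_nth[of \<Gamma> x \<sigma>] by (simp add: ctx_over_def)
  show ?case
    using Prj_comparison[OF S.ctx_sorts_in_Ob[OF \<Gamma>] i]
    by (simp add: ctx_proj_def ctx_comparison_def map_sort_int_image del: map_map)
next
  case (Fn f Ms)
  let ?cs = "map (sort_int S) (fun_dom Sg f)"
  have \<sigma>s: "set (fun_dom Sg f) \<subseteq> Sorts Sg"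
    using Fn(1) by (rule S.fun_dom)
  \<comment> \<open>The premise on the arguments pairs typing with the induction hypothesis; the two
    halves are separated here.\<close>
  have Ms: "list_all2 (tm_in_ctx Sg \<Gamma>) Ms (fun_dom Sg f)"
    using Fn(2) by (rule list_all2_mono) simp
  have IH: "arr_map F (tm_int C S \<Gamma> M) = Cmp D (tm_int D FS \<Gamma> M) (ctx_comparison \<Gamma>)"
    if "M \<in> set Ms" for M
    using Fn(2) that by (auto simp: list_all2_conv_all_nth in_set_conv_nth)
  let ?t = "tuple C (ctx_int C S \<Gamma>) (map (tm_int C S \<Gamma>) Ms)"
  let ?t' = "tuple D (ctx_int D FS \<Gamma>) (map (tm_int D FS \<Gamma>) Ms)"
  let ?i = "inverse_arr D (comparison ?cs)"
  note cs = S.sorts_in_Ob[OF \<sigma>s]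
  note a = ctx_comparison_in_hom[OF \<Gamma>]
  note f = S.fun_int_in_hom[OF Fn(1)]
  note t = C.tuple_in_hom[OF S.tm_ints_cone[OF \<Gamma> \<sigma>s Ms]]
  note t' = D.tuple_in_hom[OF image.tm_ints_cone[OF \<Gamma> \<sigma>s Ms], unfolded map_sort_int_image]
  note i = inverse_comparison(1)[OF cs]
  \<comment> \<open>The inverse obtained by solving for the image of the argument tuple is the one
    inside \<open>fun_int FS f\<close>, so only reassociation remains.\<close>
  have "arr_map F ?t = Cmp D ?i (Cmp D ?t' (ctx_comparison \<Gamma>))"
    using inverse_comparison_cmp_eq[OF cs arr_map[OF t] tms_comparison[OF \<Gamma> \<sigma>s Ms IH]] by simp
  then show ?case
    using D.cmp_assoc[OF D.cmp_in_hom[OF a t'] i arr_map[OF f]]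
      D.cmp_assoc[OF a t' D.cmp_in_hom[OF i arr_map[OF f]]]
    by (simp add: fun_int_image arr_map_cmp[OF t f])
qed

text \<open>The square behind the quantifier case. Its lower path is factored so that
  \<open>comparison [g, s]\<close> meets the compatibility of F with quantifiers and
  \<open>times_ide\<close> meets their naturality in D.\<close>

lemma ctx_ext_arr_image:
  assumes \<Gamma>x: "ctx_over Sg (\<Gamma> @ [(x, \<sigma>)])"
  defines "g \<equiv> ctx_int C S \<Gamma>" and "s \<equiv> sort_int S \<sigma>"
  shows "Cmp D (ctx_comparison (\<Gamma> @ [(x, \<sigma>)])) (arr_map F (ctx_ext_arr C S \<Gamma> \<sigma>)) =
    Cmp D (ctx_ext_arr D FS \<Gamma> \<sigma>)
      (Cmp D (times_ide D (ctx_comparison \<Gamma>) (ob_map F s)) (comparison [g, s]))"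
proof -
  have \<Gamma>: "ctx_over Sg \<Gamma>" and \<sigma>: "\<sigma> \<in> Sorts Sg"
    using \<Gamma>x by (auto simp: ctx_over_def)
  have gs: "g \<in> Ob C" "s \<in> Ob C"
    using \<Gamma> \<sigma> by (auto simp: g_def s_def S.ctx_int_in_Ob S.sort_int_in_Ob)
  let ?g' = "ctx_int D FS \<Gamma>" and ?s' = "sort_int FS \<sigma>" and ?a = "ctx_comparison \<Gamma>"
  let ?p = "proj1 C g s" and ?q = "proj2 C g s"
  let ?p' = "proj1 D ?g' ?s'" and ?q' = "proj2 D ?g' ?s'"
  have s': "?s' = ob_map F s"
    by (simp add: s_def sort_int_image)
  have gs': "?g' \<in> Ob D" "?s' \<in> Ob D"
    using \<Gamma> \<sigma> by (auto simp: image.ctx_int_in_Ob image.sort_int_in_Ob)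
  note a = ctx_comparison_in_hom[OF \<Gamma>, folded g_def]
  note p = C.proj1_in_hom[OF gs] and q = C.proj2_in_hom[OF gs]
  note Fp = arr_map[OF p] and Fq = arr_map[OF q, folded s']
  note aFp = D.cmp_in_hom[OF Fp a]
  \<comment> \<open>\<open>?h\<close> is the pair to which the product arrow after the binary
    comparison simplifies.\<close>
  let ?h = "pair D (Cmp D ?a (arr_map F ?p)) (arr_map F ?q)"
  note h = D.pair_in_hom[OF aFp Fq]
  have h_eq: "Cmp D (times_ide D ?a (ob_map F s)) (comparison [g, s]) = ?h"
    unfolding comparison_binary[OF gs] using D.times_ide_pair[OF a Fp Fq] by (simp add: s')
  \<comment> \<open>On the components coming from \<Gamma>, \<open>?p'\<close> extracts the first
    coordinate of \<open>?h\<close>; projecting further through \<open>?a\<close> gives the images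
    of the projections of \<Gamma> in C.\<close>
  have proj: "map (\<lambda>f. Cmp D f ?h) (map (\<lambda>p. Cmp D p ?p') (ctx_proj D FS \<Gamma>)) =
      map (arr_map F) (map (\<lambda>f. Cmp C f ?p) (ctx_proj C S \<Gamma>))"
  proof -
    note r = is_cone_arr[OF image.ctx_proj_cone[OF \<Gamma>]]
    have "map (\<lambda>f. Cmp D f ?h) (map (\<lambda>p. Cmp D p ?p') (ctx_proj D FS \<Gamma>)) =
        map (\<lambda>f. Cmp D f (arr_map F ?p)) (map (\<lambda>p. Cmp D p ?a) (ctx_proj D FS \<Gamma>))"
      by (simp add: D.cmp_assoc[OF h D.proj1_in_hom[OF gs'] r] D.cmp_assoc[OF Fp a r]
          D.proj1_pair[OF aFp Fq])
    also have "\<dots> = map (arr_map F) (map (\<lambda>f. Cmp C f ?p) (ctx_proj C S \<Gamma>))"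
      unfolding ctx_proj_image[OF \<Gamma>]
      by (simp add: arr_map_cmp[OF p is_cone_arr[OF S.ctx_proj_cone[OF \<Gamma>, folded g_def]]])
    finally show ?thesis .
  qed
  have "map (\<lambda>f. Cmp D f ?h) (map (\<lambda>p. Cmp D p ?p') (ctx_proj D FS \<Gamma>) @ [?q']) =
      map (arr_map F) (map (\<lambda>f. Cmp C f ?p) (ctx_proj C S \<Gamma>) @ [?q])"
    using proj D.proj2_pair[OF aFp Fq] by (simp del: map_map)
  then have "Cmp D (ctx_ext_arr D FS \<Gamma> \<sigma>) ?h =
      tuple D (ob_map F (times_ob C g s))
        (map (arr_map F) (map (\<lambda>f. Cmp C f ?p) (ctx_proj C S \<Gamma>) @ [?q]))"
    using D.tuple_cmp[OF image.ctx_ext_cone[OF \<Gamma>x] h]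
    by (simp add: ctx_ext_arr_def Let_def del: map_map map_append)
  \<comment> \<open>The other path reaches the same tuple, directly from the components of
    \<open>ctx_ext_arr\<close>.\<close>
  moreover have "Cmp D (ctx_comparison (\<Gamma> @ [(x, \<sigma>)])) (arr_map F (ctx_ext_arr C S \<Gamma> \<sigma>)) =
      tuple D (ob_map F (times_ob C g s))
        (map (arr_map F) (map (\<lambda>f. Cmp C f ?p) (ctx_proj C S \<Gamma>) @ [?q]))"
    using comparison_tuple[OF S.ctx_ext_cone[OF \<Gamma>x]]
    by (simp add: ctx_ext_arr_def ctx_comparison_def Let_def g_def s_def del: map_map map_append)
  ultimately show ?thesis
    by (simp add: h_eq)
qed

text \<open>In the atomic cases naturality of \<open>elt_map F\<close> reduces the claim to an
  identity between the arrows pulled back along; connectives commute with \<open>elt_map F\<close>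
  and with pullback alike.\<close>

lemma fm_int_image:
  assumes "fm_in_ctx L Sg \<Gamma> \<phi>" and "ctx_over Sg \<Gamma>"
  shows "elt_map F (ctx_int C S \<Gamma>) (fm_int C S \<Gamma> \<phi>) = Pull D (ctx_comparison \<Gamma>) (fm_int D FS \<Gamma> \<phi>)"
  using assms
proof induction
  case (Rel R \<Gamma> Ms)
  let ?cs = "map (sort_int S) (rel_dom Sg R)"
  note \<sigma>s = S.rel_dom[OF Rel(1)]
  note cs = S.sorts_in_Ob[OF \<sigma>s]
  note R = S.rel_int_in_elts[OF Rel(1)]
  let ?t = "tuple C (ctx_int C S \<Gamma>) (map (tm_int C S \<Gamma>) Ms)"
  let ?t' = "tuple D (ctx_int D FS \<Gamma>) (map (tm_int D FS \<Gamma>) Ms)"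
  let ?i = "inverse_arr D (comparison ?cs)"
  note a = ctx_comparison_in_hom[OF Rel(3)]
  note t = C.tuple_in_hom[OF S.tm_ints_cone[OF Rel(3) \<sigma>s Rel(2)]]
  note t' = D.tuple_in_hom[OF image.tm_ints_cone[OF Rel(3) \<sigma>s Rel(2)], unfolded map_sort_int_image]
  note i = inverse_comparison(1)[OF cs]
  have M: "arr_map F (tm_int C S \<Gamma> M) = Cmp D (tm_int D FS \<Gamma> M) (ctx_comparison \<Gamma>)"
    if "M \<in> set Ms" for M
    using Rel(2) that tm_int_image[OF Rel(3)] by (auto simp: list_all2_conv_all_nth in_set_conv_nth)
  \<comment> \<open>The inverse is again the one in the definition of the image structure, here in
    \<open>rel_int FS R\<close>; functoriality of pullback then does the rest.\<close>
  have Ft: "arr_map F ?t = Cmp D ?i (Cmp D ?t' (ctx_comparison \<Gamma>))"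
    using inverse_comparison_cmp_eq[OF cs arr_map[OF t] tms_comparison[OF Rel(3) \<sigma>s Rel(2) M]]
    by simp
  have FR: "elt_map F (Prd C ?cs) (rel_int S R) \<in> elts D (ob_map F (Prd C ?cs))"
    by (intro elt_map_in_elts C.Prd_in_Ob cs R)
  show ?case
    using D.pull_cmp[OF D.cmp_in_hom[OF a t'] i FR] D.pull_cmp[OF a t' D.Pull_in_elts[OF i FR]]
    by (simp add: elt_map_natural[OF t R] Ft rel_int_image)
next
  case (Equal \<Gamma> M \<sigma> N)
  let ?s = "sort_int S \<sigma>"
  have s: "?s \<in> Ob C"
    using Equal by (simp add: S.sort_int_in_Ob S.tm_in_ctx_sort)
  note M = S.tm_int_in_hom[OF Equal(3,1)] and N = S.tm_int_in_hom[OF Equal(3,2)]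
  note M' = image.tm_int_in_hom[OF Equal(3,1), unfolded sort_int_image]
    and N' = image.tm_int_in_hom[OF Equal(3,2), unfolded sort_int_image]
  note a = ctx_comparison_in_hom[OF Equal(3)]
  note MN = C.pair_in_hom[OF M N] and MN' = D.pair_in_hom[OF M' N']
  have c: "comparison [?s, ?s] \<in>
      hom_set D (ob_map F (times_ob C ?s ?s)) (times_ob D (ob_map F ?s) (ob_map F ?s))"
    using comparison_in_hom[of "[?s, ?s]"] s by (simp add: times_ob_def)
  \<comment> \<open>By \<open>elt_map_eql\<close> the image of the equality element is a pullback
    along this comparison, so both sides of the goal pull back the equality element of D, along
    these two arrows.\<close>
  have "Cmp D (comparison [?s, ?s]) (arr_map F (pair C (tm_int C S \<Gamma> M) (tm_int C S \<Gamma> N))) =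
      Cmp D (pair D (tm_int D FS \<Gamma> M) (tm_int D FS \<Gamma> N)) (ctx_comparison \<Gamma>)"
    by (simp add: comparison_pair[OF M N] tm_int_image[OF Equal(3,1)] tm_int_image[OF Equal(3,2)]
        D.pair_cmp[OF M' N' a])
  then show ?case
    using D.pull_cmp[OF arr_map[OF MN] c D.eql_elts[OF ob_map[OF s]]]
      D.pull_cmp[OF a MN' D.eql_elts[OF ob_map[OF s]]]
    by (simp add: elt_map_natural[OF MN C.eql_elts[OF s]] elt_map_eql[OF s] sort_int_image)
next
  case (Conn k \<phi>s \<Gamma>)
  let ?xs = "map (fm_int C S \<Gamma>) \<phi>s" and ?ys = "map (fm_int D FS \<Gamma>) \<phi>s"
  have k: "k \<in> conns_of_arity L (length ?xs)" "k \<in> conns_of_arity L (length ?ys)"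
    using Conn(1) by simp_all
  have xs: "set ?xs \<subseteq> elts C (ctx_int C S \<Gamma>)"
    using Conn S.fm_int_in_elts by auto
  have ys: "set ?ys \<subseteq> elts D (ctx_int D FS \<Gamma>)"
    using Conn image.fm_int_in_elts by auto
  have "map (elt_map F (ctx_int C S \<Gamma>)) ?xs = map (Pull D (ctx_comparison \<Gamma>)) ?ys"
    using Conn by simp
  then show ?case
    using elt_map_con[OF S.ctx_int_in_Ob[OF Conn(3)] k(1) xs]
      D.pull_con[OF ctx_comparison_in_hom[OF Conn(3)] k(2) ys]
    by (simp del: map_map)
next
  case (Quant q \<Gamma> x \<sigma> \<phi>)
  let ?g = "ctx_int C S \<Gamma>" and ?s = "sort_int S \<sigma>" and ?\<Gamma>x = "\<Gamma> @ [(x, \<sigma>)]"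
  let ?e = "ctx_ext_arr C S \<Gamma> \<sigma>" and ?e' = "ctx_ext_arr D FS \<Gamma> \<sigma>"
  let ?c = "comparison [?g, ?s]" and ?a = "ctx_comparison \<Gamma>" and ?ax = "ctx_comparison ?\<Gamma>x"
  let ?\<phi> = "fm_int C S ?\<Gamma>x \<phi>" and ?\<phi>' = "fm_int D FS ?\<Gamma>x \<phi>"
  let ?t = "times_ide D ?a (ob_map F ?s)"
  have s: "?s \<in> Ob C"
    using Quant(2) by (simp add: ctx_over_def S.sort_int_in_Ob)
  note g = S.ctx_int_in_Ob[OF Quant(5)]
  have gs: "set [?g, ?s] \<subseteq> Ob C"
    using g s by simp
  note e = S.ctx_ext_arr_in_hom[OF Quant(2)]
    and e' = image.ctx_ext_arr_in_hom[OF Quant(2), unfolded sort_int_image]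
  note \<phi> = S.fm_int_in_elts[OF Quant(3,2)] and \<phi>' = image.fm_int_in_elts[OF Quant(3,2)]
  note a = ctx_comparison_in_hom[OF Quant(5)] and ax = ctx_comparison_in_hom[OF Quant(2)]
  note t = D.times_ide_in_hom[OF a ob_map[OF s]]
  have c: "?c \<in> hom_set D (ob_map F (times_ob C ?g ?s)) (times_ob D (ob_map F ?g) (ob_map F ?s))"
    using comparison_in_hom[OF gs] by (simp add: times_ob_def)
  have i: "inverse_arr D ?c \<in>
      hom_set D (times_ob D (ob_map F ?g) (ob_map F ?s)) (ob_map F (times_ob C ?g ?s))"
    using inverse_comparison(1)[OF gs] by (simp add: times_ob_def)
  have ci: "Cmp D ?c (inverse_arr D ?c) = Ide D (times_ob D (ob_map F ?g) (ob_map F ?s))"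
    using inverse_comparison(3)[OF gs] by (simp add: times_ob_def)
  note e'\<phi>' = D.Pull_in_elts[OF e' \<phi>']
  note te'\<phi>' = D.Pull_in_elts[OF t e'\<phi>']
  have "elt_map F (times_ob C ?g ?s) (Pull C ?e ?\<phi>) = Pull D (arr_map F ?e) (Pull D ?ax ?\<phi>')"
    using elt_map_natural[OF e \<phi>] Quant(4)[OF Quant(2)] by simp
  also have "\<dots> = Pull D (Cmp D ?e' (Cmp D ?t ?c)) ?\<phi>'"
    using D.pull_cmp[OF arr_map[OF e] ax \<phi>'] ctx_ext_arr_image[OF Quant(2)] by simp
  also have "\<dots> = Pull D ?c (Pull D ?t (Pull D ?e' ?\<phi>'))"
    by (simp add: D.pull_cmp[OF D.cmp_in_hom[OF c t] e' \<phi>'] D.pull_cmp[OF c t e'\<phi>'])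
  \<comment> \<open>Pullback is contravariant, so pulling back along \<open>?c\<close> and then
    along its inverse is pulling back along the identity \<open>ci\<close>.\<close>
  finally have "Pull D (inverse_arr D ?c) (elt_map F (times_ob C ?g ?s) (Pull C ?e ?\<phi>)) =
      Pull D ?t (Pull D ?e' ?\<phi>')"
    using D.pull_cmp[OF i c te'\<phi>']
      D.pull_ide[OF D.times_ob_in_Ob[OF ob_map[OF g] ob_map[OF s]] te'\<phi>']
    by (simp add: ci)
  \<comment> \<open>\<open>elt_map_qnt\<close> produces the left-hand side just computed;
    naturality, read from right to left, trades the pullback along \<open>?t\<close> under the
    quantifier for one along \<open>?a\<close> outside it.\<close>
  then show ?case
    using elt_map_qnt[OF Quant(1) g s C.Pull_in_elts[OF e \<phi>]]
      D.qnt_natural[OF Quant(1) a ob_map[OF s] e'\<phi>']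
    by (simp add: sort_int_image)
qed

section \<open>Transfer of satisfaction along the comparison isomorphisms\<close>

lemma ctx_comparison_pull_reflects_le:
  assumes \<Gamma>: "ctx_over Sg \<Gamma>"
    and x: "x \<in> elts D (ctx_int D FS \<Gamma>)" and y: "y \<in> elts D (ctx_int D FS \<Gamma>)"
    and le: "Pull D (ctx_comparison \<Gamma>) x \<sqsubseteq>\<^bsub>Fib D (ob_map F (ctx_int C S \<Gamma>))\<^esub>
      Pull D (ctx_comparison \<Gamma>) y"
  shows "x \<sqsubseteq>\<^bsub>Fib D (ctx_int D FS \<Gamma>)\<^esub> y"
proof -
  let ?i = "inverse_arr D (ctx_comparison \<Gamma>)"
  note a = ctx_comparison_in_hom[OF \<Gamma>]
  have i: "?i \<in> hom_set D (ctx_int D FS \<Gamma>) (ob_map F (ctx_int C S \<Gamma>))"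
    using inverse_comparison(1)[OF S.ctx_sorts_in_Ob[OF \<Gamma>]]
    by (simp add: ctx_comparison_def ctx_int_image ctx_int_def[of C] sorts_int_def)
  have ai: "Cmp D (ctx_comparison \<Gamma>) ?i = Ide D (ctx_int D FS \<Gamma>)"
    using inverse_comparison(3)[OF S.ctx_sorts_in_Ob[OF \<Gamma>]]
    by (simp add: ctx_comparison_def ctx_int_image)
  \<comment> \<open>Pullback along the inverse undoes pullback along the comparison; as it is also
    monotone, it carries the assumed inequality back to \<open>x\<close> and
    \<open>y\<close>.\<close>
  have inv: "Pull D ?i (Pull D (ctx_comparison \<Gamma>) z) = z" if "z \<in> elts D (ctx_int D FS \<Gamma>)" for z
    using D.pull_cmp[OF i a that] D.pull_ide[OF D.hom_obs(2)[OF a] that]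
    by (simp add: ai)
  have "Pull D ?i (Pull D (ctx_comparison \<Gamma>) x) \<sqsubseteq>\<^bsub>Fib D (ctx_int D FS \<Gamma>)\<^esub>
      Pull D ?i (Pull D (ctx_comparison \<Gamma>) y)"
    using D.pull_mono[OF i] le D.Pull_in_elts[OF a x] D.Pull_in_elts[OF a y]
    by (simp add: isotone_def)
  then show ?thesis
    by (simp add: inv x y)
qed

lemma satisfies_image:
  assumes "assertion_over L Sg A" and "satisfies L C S A"
  shows "satisfies L D FS A"
proof (cases A)
  case (Equation \<Gamma> \<tau> M N)
  then have \<Gamma>: "ctx_over Sg \<Gamma>" and M: "tm_in_ctx Sg \<Gamma> M \<tau>" and N: "tm_in_ctx Sg \<Gamma> N \<tau>"
    and eq: "tm_int C S \<Gamma> M = tm_int C S \<Gamma> N"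
    using assms by simp_all
  have "Cmp D (tm_int D FS \<Gamma> M) (ctx_comparison \<Gamma>) = Cmp D (tm_int D FS \<Gamma> N) (ctx_comparison \<Gamma>)"
    using tm_int_image[OF \<Gamma> M] tm_int_image[OF \<Gamma> N] eq by simp
  then have "tm_int D FS \<Gamma> M = tm_int D FS \<Gamma> N"
    unfolding ctx_comparison_def
    by (rule comparison_cancel_right[OF S.ctx_sorts_in_Ob[OF \<Gamma>]
          image.tm_int_in_hom[OF \<Gamma> M, unfolded ctx_int_image]
          image.tm_int_in_hom[OF \<Gamma> N, unfolded ctx_int_image]])
  with Equation show ?thesis by simp
next
  case (Sequent \<Gamma> \<phi>s \<phi>)
  let ?g = "ctx_int C S \<Gamma>" and ?g' = "ctx_int D FS \<Gamma>" and ?a = "ctx_comparison \<Gamma>"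
  let ?xs = "map (fm_int C S \<Gamma>) \<phi>s" and ?ys = "map (fm_int D FS \<Gamma>) \<phi>s"
  have \<Gamma>: "ctx_over Sg \<Gamma>" and \<phi>s: "\<And>\<psi>. \<psi> \<in> set \<phi>s \<Longrightarrow> fm_in_ctx L Sg \<Gamma> \<psi>"
    and \<phi>: "fm_in_ctx L Sg \<Gamma> \<phi>"
    and le: "tensor_list L C ?g ?xs \<sqsubseteq>\<^bsub>Fib C ?g\<^esub> fm_int C S \<Gamma> \<phi>"
    using assms Sequent by simp_all
  note g = S.ctx_int_in_Ob[OF \<Gamma>] and g' = image.ctx_int_in_Ob[OF \<Gamma>]
  have xs: "set ?xs \<subseteq> elts C ?g" and ys: "set ?ys \<subseteq> elts D ?g'"
    by (auto intro: S.fm_int_in_elts image.fm_int_in_elts \<phi>s \<Gamma>)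
  have "map (elt_map F ?g) ?xs = map (Pull D ?a) ?ys"
    using \<phi>s by (simp add: fm_int_image \<Gamma>)
  \<comment> \<open>\<open>elt_map F ?g\<close> and pullback along \<open>?a\<close> both preserve
    tensors, so agreement on the single hypotheses extends to their tensor.\<close>
  then have "elt_map F ?g (tensor_list L C ?g ?xs) = Pull D ?a (tensor_list L D ?g' ?ys)"
    by (simp only: elt_map_tensor_list[OF g xs]
        D.pull_tensor_list[OF ctx_comparison_in_hom[OF \<Gamma>] ys])
  \<comment> \<open>Monotonicity moves the inequality to the fibre over \<open>ob_map F ?g\<close>,
    where both sides are pullbacks along \<open>?a\<close>.\<close>
  moreover have "elt_map F ?g (tensor_list L C ?g ?xs)
      \<sqsubseteq>\<^bsub>Fib D (ob_map F ?g)\<^esub> elt_map F ?g (fm_int C S \<Gamma> \<phi>)"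
    using elt_map_mono[OF g] le C.tensor_list_in_elts[OF g xs] S.fm_int_in_elts[OF \<phi> \<Gamma>]
    by (simp add: isotone_def)
  ultimately have "tensor_list L D ?g' ?ys \<sqsubseteq>\<^bsub>Fib D ?g'\<^esub> fm_int D FS \<Gamma> \<phi>"
    using ctx_comparison_pull_reflects_le[OF \<Gamma> D.tensor_list_in_elts[OF g' ys]
        image.fm_int_in_elts[OF \<phi> \<Gamma>]]
    by (simp add: fm_int_image[OF \<phi> \<Gamma>])
  with Sequent show ?thesis by simp
qed

end

theorem mainTheorem5:
  fixes L :: "('k, 'q) lang"
    and C :: "('o1, 'm1, 'p1, 'k, 'q) fa"
    and D :: "('o2, 'm2, 'p2, 'k, 'q) fa"
    and F :: "('o1, 'm1, 'p1, 'o2, 'm2, 'p2) fa_map"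
    and Sg :: "('s, 'f, 'r) sig"
    and T :: "('s, 'f, 'r, 'k, 'q, 'v) assertion set"
    and S :: "('s, 'f, 'r, 'o1, 'm1, 'p1) struc"
  assumes "language L"
    and "fa_object L C"
    and "fa_object L D"
    and "fa_morphism L C D F"
    and "signature Sg"
    and "theory_over L Sg T"
    and "is_model L Sg T C S"
  shows "is_model L Sg T D (image_struc Sg C D F S)"
proof -
  interpret fa_morphism L C D F by fact
  interpret signature Sg by fact
  interpret fa_structure_image L C D F Sg S
    using assms(7) by unfold_locales (simp add: is_model_def)
  \<comment> \<open>\<open>theory_over\<close> supplies the well-formedness of each assertion on
    which the transfer of satisfaction depends.\<close>
  show ?thesis
    using assms(6,7) is_structure_image satisfies_image by (auto simp: is_model_def theory_over_def)
qed

end
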